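(* Assume that $K<+\infty$. Let $0<a\le b<+\infty$ and $0<c\le d<+\infty$ be fixed. Let $J=[a,b]\times[c,d]$ or $J=[a,b]\times(0,\infty)$ or $J=(0,\infty)\times[c,d]$, and assume that there exists $(\tilde\theta,\tilde\sigma^2)\in J$ such that $\tilde\theta\tilde\sigma^2=\theta_0\sigma_0^2$. Then $\hat\theta_{pc\ell}\hat\sigma^2_{pc\ell}$ converges to $\theta_0\sigma_0^2$ almost surely as $n\to\infty$.
   Context: $Z=\{Z(s),s\in[0,1]\}$ is a stationary zero-mean Gaussian process (the stationary Ornstein-Uhlenbeck process, with almost surely continuous sample paths) with covariance $\mathrm{cov}\{Z(s),Z(t)\}=\sigma_0^2e^{-\theta_0|s-t|}$, for fixed (true) $\theta_0,\sigma_0^2\in(0,\infty)$. For each $n$, the observation points are $s_1<\dots<s_n$ in $[0,1]$, where $s_i=s_i^{(n)}$ is a (deterministic) triangular array; the observations are $Z(s_1),\dots,Z(s_n)$. Weights: $(w_k)_{k\ge1}$ is a fixed sequence of non-negative numbers, not all zero (not depending on $n$), and $K=\max\{k\ge 1: w_k\ne0\}$ (with $K=+\infty$ if infinitely many $w_k$ are non-zero). For $\psi=(\theta,\sigma^2)^\top\in(0,\infty)^2$ and $s\ne t\in[0,1]$ let $$\ell_{t|s}(\psi)=\ln(\sigma^2)+\ln(1-e^{-2\theta|s-t|})+\frac{\{Z(t)-e^{-\theta|s-t|}Z(s)\}^2}{\sigma^2(1-e^{-2\theta|s-t|})}.$$ The weighted pairwise conditional log-likelihood is $$pc\ell_n(\psi)=\sum_{i=1}^{n}\sum_{j=1,\,j\ne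 i}^n w_{|i-j|}\,\ell_{s_j|s_i}(\psi),$$ and the weighted pairwise conditional maximum likelihood estimator over $J$ is $\hat\psi_{pc\ell}=(\hat\theta_{pc\ell},\hat\sigma^2_{pc\ell})^\top=\mathrm{argmin}_{\psi\in J}\,pc\ell_n(\psi)$ (a minimizer of $pc\ell_n$ over $J$). *)

theory Defs
  imports "HOL-Probability.Probability"
begin

section \<open>The Ornstein-Uhlenbeck process\<close>

text \<open>Degenerate (almost surely constant) normal laws are included, because
  \<^const>\<open>normal_density\<close> only describes a law with positive variance and linear combinations
  of Gaussian variables may degenerate.\<close>

definition gaussian_rv :: "'a measure \<Rightarrow> ('a \<Rightarrow> real) \<Rightarrow> bool" where
  "gaussian_rv M X \<longleftrightarrow>
     X \<in> borel_measurable M \<and>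
     (\<exists>\<mu>. (AE \<omega> in M. X \<omega> = \<mu>) \<or>
          (\<exists>\<sigma>>0. distributed M lborel X (normal_density \<mu> \<sigma>)))"

definition gaussian_process :: "'a measure \<Rightarrow> 't set \<Rightarrow> ('t \<Rightarrow> 'a \<Rightarrow> real) \<Rightarrow> bool" where
  "gaussian_process M T Z \<longleftrightarrow>
     (\<forall>F c. finite F \<and> F \<subseteq> T \<longrightarrow> gaussian_rv M (\<lambda>\<omega>. \<Sum>t\<in>F. c t * Z t \<omega>))"

definition covariance :: "'a measure \<Rightarrow> ('a \<Rightarrow> real) \<Rightarrow> ('a \<Rightarrow> real) \<Rightarrow> real" where
  "covariance M X Y =
     integral\<^sup>L M (\<lambda>\<omega>. (X \<omega> - integral\<^sup>L M X) * (Y \<omega> - integral\<^sup>L M Y))"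

text \<open>The parameters are \<open>\<theta>\<close> and the variance \<open>v\<close> (that is, \<open>\<sigma>\<^sup>2\<close>).\<close>

definition OU_process :: "'a measure \<Rightarrow> (real \<Rightarrow> 'a \<Rightarrow> real) \<Rightarrow> real \<Rightarrow> real \<Rightarrow> bool" where
  "OU_process M Z \<theta> v \<longleftrightarrow>
     prob_space M \<and>
     gaussian_process M {0..1} Z \<and>
     (\<forall>t\<in>{0..1}. integral\<^sup>L M (Z t) = 0) \<and>
     (\<forall>s\<in>{0..1}. \<forall>t\<in>{0..1}. covariance M (Z s) (Z t) = v * exp (- \<theta> * \<bar>s - t\<bar>)) \<and>
     (AE \<omega> in M. continuous_on {0..1} (\<lambda>t. Z t \<omega>))"

section \<open>Weighted pairwise conditional likelihood\<close>

text \<open>Only the weights \<open>w k\<close> with \<open>k \<ge> 1\<close> are meaningful; the value \<open>w 0\<close> is never used.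
  For weights that are not all zero, the supremum is the largest index of a non-zero weight, and
  it is \<open>\<infinity>\<close> if infinitely many weights are non-zero.\<close>

definition weight_range :: "(nat \<Rightarrow> real) \<Rightarrow> enat" where
  "weight_range w = (SUP k\<in>{k. 1 \<le> k \<and> w k \<noteq> 0}. enat k)"

text \<open>Here \<open>z\<close> is a sample path; this is the term for \<open>z t\<close> given \<open>z s\<close>.\<close>

definition cond_loglik :: "(real \<Rightarrow> real) \<Rightarrow> real \<Rightarrow> real \<Rightarrow> real \<times> real \<Rightarrow> real" where
  "cond_loglik z s t \<psi> = (case \<psi> of (\<theta>, v) \<Rightarrow>
     ln v + ln (1 - exp (- 2 * \<theta> * \<bar>s - t\<bar>)) +
     (z t - exp (- \<theta> * \<bar>s - t\<bar>) * z s)\<^sup>2 / (v * (1 - exp (- 2 * \<theta> * \<bar>s - t\<bar>))))"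

definition pair_cond_loglik ::
    "(nat \<Rightarrow> real) \<Rightarrow> nat \<Rightarrow> (nat \<Rightarrow> real) \<Rightarrow> (real \<Rightarrow> real) \<Rightarrow> real \<times> real \<Rightarrow> real" where
  "pair_cond_loglik w n s z \<psi> =
     (\<Sum>i\<in>{1..n}. \<Sum>j\<in>{1..n} - {i}.
        w (nat \<bar>int i - int j\<bar>) * cond_loglik z (s i) (s j) \<psi>)"

definition observation_array :: "(nat \<Rightarrow> nat \<Rightarrow> real) \<Rightarrow> bool" where
  "observation_array s \<longleftrightarrow>
     (\<forall>n. strict_mono_on {1..n} (s n) \<and> s n ` {1..n} \<subseteq> {0..1})"

text \<open>An estimator is any choice of a minimizer over \<open>J\<close>. On the non-compact sets \<open>J\<close> a minimizer
  need not exist for every outcome and every sample size, so a minimizer is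
  only demanded almost surely for all sufficiently large \<open>n\<close>; no measurability is demanded.\<close>

definition pair_cond_MLE ::
    "'a measure \<Rightarrow> (real \<Rightarrow> 'a \<Rightarrow> real) \<Rightarrow> (nat \<Rightarrow> real) \<Rightarrow> (nat \<Rightarrow> nat \<Rightarrow> real) \<Rightarrow>
     (real \<times> real) set \<Rightarrow> (nat \<Rightarrow> 'a \<Rightarrow> real \<times> real) \<Rightarrow> bool" where
  "pair_cond_MLE M Z w s J \<psi>hat \<longleftrightarrow>
     (AE \<omega> in M. \<forall>\<^sub>F n in sequentially.
        is_arg_min (pair_cond_loglik w n (s n) (\<lambda>t. Z t \<omega>)) (\<lambda>\<psi>. \<psi> \<in> J) (\<psi>hat n \<omega>))"

end

(* The product theta * v is identified through the innovations of the process. For consecutive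
   points of one residue class modulo the lag k, the normalised innovations are independent standard
   normal variables, so Chernoff bounds and Borel-Cantelli give a strong law for their squares along
   any triangular array, with no assumption on the spacings. Pathwise, the conditional variance
   v (1 - exp (- 2 theta delta)) equals 2 theta v delta up to a factor 1 + O(delta), and the spacings
   at a fixed lag have a bounded sum; hence, with R = theta0 v0 / (theta v), the likelihood is
   2 n (sum of the weights) (R - ln R) plus a term independent of theta and v, up to
   o(n) (1 + R + |ln R|), uniformly for bounded theta and all v. Since R - ln R has its only
   minimum at R = 1, minimisers satisfy R --> 1. If theta is unbounded then v is bounded below, and
   large theta is excluded because the logarithmic term alone exceeds the optimal value. *)
theory Submission
  imports Defs
begin

section \<open>Sums of squares of orthonormal Gaussian families\<close>

text \<open>The spacings may be arbitrarily small and the points may change completely with the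
  sample size. The innovations for different \<open>n\<close> therefore form no single sequence to
  which a classical strong law applies; tail bounds summable in \<open>n\<close> take its place. All
  randomness is confined to countably many almost sure events that do not involve the parameter. On
  them the argument is deterministic and uniform in the parameter, so any selection of minimisers is
  covered, measurable or not. The delicate point is uniformity in \<open>v\<close>, which may
  approach 0 or infinity: every error is either free of \<open>v\<close> or carries a factor
  \<open>R\<close> or \<open>|ln R|\<close>, and the deficit \<open>R - 1 - ln R\<close> can absorb
  both. The constant \<open>exp 2\<close> used for large \<theta> comes from comparing values per
  pair: the optimum is about 2, whereas a conditional variance that is \<open>exp 2\<close> times
  too large costs about 4 through its logarithm alone.\<close>

lemma nn_integral_normal_density [simp]:
  assumes "0 < \<sigma>"
  shows "(\<integral>\<^sup>+x. ennreal (normal_density \<mu> \<sigma> x) \<partial>lborel) = 1"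
  using assms by (subst nn_integral_eq_integral) auto

text \<open>Completing the square: an exponential tilt only moves the mean, and the constant left
  over is the Laplace transform.\<close>

lemma normal_density_times_exp:
  assumes "0 < \<sigma>"
  shows "normal_density 0 \<sigma> x * exp (a * x) = exp (a\<^sup>2 * \<sigma>\<^sup>2 / 2) * normal_density (a * \<sigma>\<^sup>2) \<sigma> x"
proof -
  have "- x\<^sup>2 / (2 * \<sigma>\<^sup>2) + a * x = a\<^sup>2 * \<sigma>\<^sup>2 / 2 + - (x - a * \<sigma>\<^sup>2)\<^sup>2 / (2 * \<sigma>\<^sup>2)"
    using assms by (simp add: field_simps power2_eq_square)
  then show ?thesis
    by (simp add: normal_density_def mult_exp_exp)
qed

text \<open>The parameter \<open>c\<close> is the reciprocal of the new standard deviation, so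
  integration leaves the factor \<open>1 / c\<close>. Negative \<open>l\<close> (that is,
  \<open>c > 1\<close>) is included because the lower tail needs it.\<close>

lemma normal_density_times_exp_square:
  assumes "0 < c" and "l = (1 - c\<^sup>2) / 2"
  shows "std_normal_density x * exp (l * x\<^sup>2) = 1 / c * normal_density 0 (1 / c) x"
proof -
  have "- (x\<^sup>2 / 2) + l * x\<^sup>2 = - (c\<^sup>2 * x\<^sup>2 / 2)"
    unfolding assms(2) by (simp add: field_simps)
  then show ?thesis
    using assms(1)
    by (simp add: normal_density_def mult_exp_exp power_divide real_sqrt_divide)
qed

lemma nn_integral_std_normal_exp:
  "(\<integral>\<^sup>+x. ennreal (std_normal_density x * exp (a * x)) \<partial>lborel) = ennreal (exp (a\<^sup>2 / 2))"
  by (subst normal_density_times_exp) (simp_all add: ennreal_mult' nn_integral_cmult)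

text \<open>This is the Laplace transform of the chi-squared law with one degree of freedom.\<close>

lemma nn_integral_std_normal_exp_square:
  assumes "l < 1 / 2"
  shows "(\<integral>\<^sup>+x. ennreal (std_normal_density x * exp (l * x\<^sup>2)) \<partial>lborel) = ennreal (1 / sqrt (1 - 2 * l))"
proof -
  have "(\<integral>\<^sup>+x. ennreal (std_normal_density x * exp (l * x\<^sup>2)) \<partial>lborel) =
      (\<integral>\<^sup>+x. ennreal (1 / sqrt (1 - 2 * l)) * ennreal (normal_density 0 (1 / sqrt (1 - 2 * l)) x) \<partial>lborel)"
    using assms by (intro nn_integral_cong, subst normal_density_times_exp_square[of "sqrt (1 - 2 * l)"])
      (simp_all add: ennreal_mult'[symmetric])
  also have "\<dots> = ennreal (1 / sqrt (1 - 2 * l))"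
    using assms by (subst nn_integral_cmult) auto
  finally show ?thesis .
qed

lemma integral_std_normal_exp_square:
  assumes "l < 1 / 2"
  shows "(\<integral>x. std_normal_density x * exp (l * x\<^sup>2) \<partial>lborel) = 1 / sqrt (1 - 2 * l)"
  using assms by (intro integral_eq_nn_integral[THEN trans])
    (auto simp: nn_integral_std_normal_exp_square)

lemma integrable_std_normal_bounded:
  fixes g :: "real \<Rightarrow> real"
  assumes [measurable]: "g \<in> borel_measurable borel" and "\<And>x. \<bar>g x\<bar> \<le> 1"
  shows "integrable lborel (\<lambda>x. std_normal_density x * g x)"
proof (rule Bochner_Integration.integrable_bound[OF integrable_normal_density[of 1 0]])
  show "AE x in lborel. norm (std_normal_density x * g x) \<le> norm (std_normal_density x)"
    using assms(2) by (auto simp: abs_mult intro!: mult_left_le)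
qed auto

text \<open>Real and imaginary parts of the characteristic function; the real form keeps complex
  integrals out of the later inductions.\<close>

lemma integral_std_normal_cos_sin:
  "(\<integral>x. std_normal_density x * cos (a * x) \<partial>lborel) = exp (- a\<^sup>2 / 2)"
  "(\<integral>x. std_normal_density x * sin (a * x) \<partial>lborel) = 0"
proof -
  interpret N: real_distribution std_normal_distribution
    by (rule real_dist_normal_dist)
  have "integrable std_normal_distribution (\<lambda>x. cis (a * x))"
    by (rule N.integrable_const_bound[where B = 1]) (auto simp: cis_conv_exp)
  then have i: "integrable std_normal_distribution (\<lambda>x. iexp (a * x))"
    by (simp add: cis_conv_exp)
  have eq: "(CLINT x|std_normal_distribution. iexp (a * x)) = complex_of_real (exp (- a\<^sup>2 / 2))"
    using char_std_normal_distribution by (simp add: char_def fun_eq_iff)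
  have "Re (CLINT x|std_normal_distribution. iexp (a * x)) = (\<integral>x. cos (a * x) \<partial>std_normal_distribution)"
    using i by (subst integral_Re[symmetric]) (simp_all add: Re_exp)
  then have c: "(\<integral>x. cos (a * x) \<partial>std_normal_distribution) = exp (- a\<^sup>2 / 2)"
    using eq by simp
  have "Im (CLINT x|std_normal_distribution. iexp (a * x)) = (\<integral>x. sin (a * x) \<partial>std_normal_distribution)"
    using i by (subst integral_Im[symmetric]) (simp_all add: Im_exp)
  then have s: "(\<integral>x. sin (a * x) \<partial>std_normal_distribution) = 0"
    using eq by simp
  show "(\<integral>x. std_normal_density x * cos (a * x) \<partial>lborel) = exp (- a\<^sup>2 / 2)"
    using c by (subst (asm) integral_density) auto
  show "(\<integral>x. std_normal_density x * sin (a * x) \<partial>lborel) = 0"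
    using s by (subst (asm) integral_density) auto
qed

text \<open>The sine part integrates to 0, so a phase factors out as a cosine. Later the phase is
  the part of a linear combination that does not involve the auxiliary variable.\<close>

lemma integral_std_normal_cos_shift:
  "(\<integral>x. std_normal_density x * cos (a * x + b) \<partial>lborel) = exp (- a\<^sup>2 / 2) * cos b"
proof -
  have "(\<integral>x. std_normal_density x * cos (a * x + b) \<partial>lborel) =
      (\<integral>x. cos b * (std_normal_density x * cos (a * x)) - sin b * (std_normal_density x * sin (a * x)) \<partial>lborel)"
    by (intro Bochner_Integration.integral_cong) (simp_all add: cos_add algebra_simps)
  also have "\<dots> = cos b * exp (- a\<^sup>2 / 2)"
    by (subst Bochner_Integration.integral_diff)
      (auto intro!: integrable_mult_right integrable_std_normal_bounded simp: integral_std_normal_cos_sin)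
  finally show ?thesis by simp
qed

section \<open>Joint transforms of squares and linear combinations\<close>

text \<open>Independence is encoded by the Laplace and Fourier transforms of the linear combinations, because
  a Gaussian process is only described by one-dimensional laws.\<close>

definition std_gaussian_family :: "'a measure \<Rightarrow> 'i set \<Rightarrow> ('i \<Rightarrow> 'a \<Rightarrow> real) \<Rightarrow> bool" where
  "std_gaussian_family M A W \<longleftrightarrow>
     (\<forall>i\<in>A. W i \<in> borel_measurable M) \<and>
     (\<forall>c. (\<integral>\<^sup>+\<omega>. ennreal (exp (\<Sum>i\<in>A. c i * W i \<omega>)) \<partial>M) = ennreal (exp ((\<Sum>i\<in>A. (c i)\<^sup>2) / 2))) \<and>
     (\<forall>c. (\<integral>\<omega>. cos (\<Sum>i\<in>A. c i * W i \<omega>) \<partial>M) = exp (- (\<Sum>i\<in>A. (c i)\<^sup>2) / 2))"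

text \<open>The squares are linearised one at a time: \<open>exp (l w\<^sup>2)\<close> is the average of
  \<open>exp (sqrt (2 l) x w)\<close> over a standard normal \<open>x\<close>, and Tonelli's theorem turns \<open>sqrt (2 l) x\<close>
  into a coefficient of the linear part.\<close>

lemma std_gaussian_family_exp_sum_squares:
  fixes c :: "'i \<Rightarrow> real"
  assumes "prob_space M" and fam: "std_gaussian_family M A W"
    and "finite A" and "B \<subseteq> A" and l: "0 \<le> l" "l < 1 / 2"
  shows "(\<integral>\<^sup>+\<omega>. ennreal (exp (l * (\<Sum>i\<in>B. (W i \<omega>)\<^sup>2) + (\<Sum>i\<in>A - B. c i * W i \<omega>))) \<partial>M) =
    ennreal ((1 / sqrt (1 - 2 * l)) ^ card B * exp ((\<Sum>i\<in>A - B. (c i)\<^sup>2) / 2))"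
proof -
  interpret prob_space M by fact
  interpret P: pair_sigma_finite lborel M ..
  have "finite B" using assms by (auto intro: finite_subset)
  then show ?thesis using \<open>B \<subseteq> A\<close>
  proof (induction B arbitrary: c rule: finite_induct)
    case empty
    then show ?case using fam by (simp add: std_gaussian_family_def)
  next
    case (insert k B)
    have W[measurable]: "W i \<in> borel_measurable M" if "i \<in> A" for i
      using fam that by (simp add: std_gaussian_family_def)
    define S where "S \<omega> = l * (\<Sum>i\<in>B. (W i \<omega>)\<^sup>2) + (\<Sum>i\<in>A - insert k B. c i * W i \<omega>)" for \<omega>
    have [measurable]: "S \<in> borel_measurable M" "W k \<in> borel_measurable M"
      using insert.prems W unfolding S_def by (auto intro!: borel_measurable_sum borel_measurable_times borel_measurable_add)
    define r where "r = sqrt (2 * l)"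
    have r2: "r\<^sup>2 = 2 * l" using l by (simp add: r_def)
    have AB: "A - B = insert k (A - insert k B)" using insert by auto
    have fA: "finite (A - insert k B)" "k \<notin> A - insert k B" using \<open>finite A\<close> by auto
    define D where "D = (\<Sum>i\<in>A - insert k B. (c i)\<^sup>2)"
    define q where "q = 1 / sqrt (1 - 2 * l)"
    have "(\<integral>\<^sup>+\<omega>. ennreal (exp (l * (\<Sum>i\<in>insert k B. (W i \<omega>)\<^sup>2) + (\<Sum>i\<in>A - insert k B. c i * W i \<omega>))) \<partial>M)
      = (\<integral>\<^sup>+\<omega>. ennreal (exp (S \<omega>)) * (\<integral>\<^sup>+x. ennreal (std_normal_density x * exp (r * W k \<omega> * x)) \<partial>lborel) \<partial>M)"
      unfolding nn_integral_std_normal_exp using insert.hyps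
      by (intro nn_integral_cong) (simp add: S_def power_mult_distrib r2 ennreal_mult'[symmetric] mult_exp_exp algebra_simps)
    also have "\<dots> = (\<integral>\<^sup>+\<omega>. (\<integral>\<^sup>+x. ennreal (std_normal_density x * exp (r * x * W k \<omega> + S \<omega>)) \<partial>lborel) \<partial>M)"
      by (intro nn_integral_cong, subst nn_integral_cmult[symmetric])
        (auto simp: ennreal_mult'[symmetric] exp_add algebra_simps intro!: nn_integral_cong)
    also have "\<dots> = (\<integral>\<^sup>+x. (\<integral>\<^sup>+\<omega>. ennreal (std_normal_density x * exp (r * x * W k \<omega> + S \<omega>)) \<partial>M) \<partial>lborel)"
      by (rule P.Fubini') measurable
    also have "\<dots> = (\<integral>\<^sup>+x. ennreal (q ^ card B * exp (D / 2)) * ennreal (std_normal_density x * exp (l * x\<^sup>2)) \<partial>lborel)"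
    proof (intro nn_integral_cong)
      fix x
      have "(\<integral>\<^sup>+\<omega>. ennreal (std_normal_density x * exp (r * x * W k \<omega> + S \<omega>)) \<partial>M) =
        ennreal (std_normal_density x) * (\<integral>\<^sup>+\<omega>. ennreal (exp (r * x * W k \<omega> + S \<omega>)) \<partial>M)"
        by (subst nn_integral_cmult[symmetric]) (auto simp: ennreal_mult')
      also have "(\<integral>\<^sup>+\<omega>. ennreal (exp (r * x * W k \<omega> + S \<omega>)) \<partial>M) =
        (\<integral>\<^sup>+\<omega>. ennreal (exp (l * (\<Sum>i\<in>B. (W i \<omega>)\<^sup>2) + (\<Sum>i\<in>A - B. (c(k := r * x)) i * W i \<omega>))) \<partial>M)"
      proof -
        have "(\<Sum>i\<in>A - B. (c(k := r * x)) i * W i \<omega>) = r * x * W k \<omega> + (\<Sum>i\<in>A - insert k B. c i * W i \<omega>)" for \<omega>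
          unfolding AB using fA by (subst sum.insert) (auto intro!: sum.cong)
        then show ?thesis by (simp add: S_def algebra_simps)
      qed
      also have "\<dots> = ennreal (q ^ card B * exp ((\<Sum>i\<in>A - B. ((c(k := r * x)) i)\<^sup>2) / 2))"
        unfolding q_def using insert.IH insert.prems by blast
      also have "(\<Sum>i\<in>A - B. ((c(k := r * x)) i)\<^sup>2) = 2 * l * x\<^sup>2 + D"
        unfolding AB using fA by (subst sum.insert) (auto intro!: sum.cong simp: D_def power_mult_distrib r2)
      finally show "(\<integral>\<^sup>+\<omega>. ennreal (std_normal_density x * exp (r * x * W k \<omega> + S \<omega>)) \<partial>M) =
        ennreal (q ^ card B * exp (D / 2)) * ennreal (std_normal_density x * exp (l * x\<^sup>2))"
        using l by (simp add: q_def ennreal_mult'[symmetric] ennreal_mult''[symmetric] add_divide_distrib exp_add algebra_simps)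
    qed
    also have "\<dots> = ennreal (q ^ card B * exp (D / 2)) * ennreal q"
      using l by (subst nn_integral_cmult) (auto simp: nn_integral_std_normal_exp_square q_def)
    also have "\<dots> = ennreal (q ^ card (insert k B) * exp (D / 2))"
      using l insert.hyps by (simp add: q_def ennreal_mult''[symmetric] algebra_simps)
    finally show ?case by (simp add: q_def D_def)
  qed
qed

text \<open>The same linearisation for a negative exponent: \<open>exp (- l w^2)\<close> is the
  average of \<open>cos (sqrt (2 l) x w)\<close> over a standard normal \<open>x\<close>. Hence the
  linear part sits in a cosine, and the Fourier clause of the family starts the induction.\<close>

lemma std_gaussian_family_exp_neg_sum_squares:
  fixes c :: "'i \<Rightarrow> real"
  assumes "prob_space M" and fam: "std_gaussian_family M A W"
    and "finite A" and "B \<subseteq> A" and l: "0 \<le> l"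
  shows "(\<integral>\<omega>. exp (- l * (\<Sum>i\<in>B. (W i \<omega>)\<^sup>2)) * cos (\<Sum>i\<in>A - B. c i * W i \<omega>) \<partial>M) =
    (1 / sqrt (1 + 2 * l)) ^ card B * exp (- (\<Sum>i\<in>A - B. (c i)\<^sup>2) / 2)"
proof -
  interpret prob_space M by fact
  interpret P: pair_sigma_finite lborel M ..
  have "finite B" using assms by (auto intro: finite_subset)
  then show ?thesis using \<open>B \<subseteq> A\<close>
  proof (induction B arbitrary: c rule: finite_induct)
    case empty
    then show ?case using fam by (simp add: std_gaussian_family_def)
  next
    case (insert k B)
    have W[measurable]: "W i \<in> borel_measurable M" if "i \<in> A" for i
      using fam that by (simp add: std_gaussian_family_def)
    define S where "S \<omega> = exp (- l * (\<Sum>i\<in>B. (W i \<omega>)\<^sup>2))" for \<omega>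
    define T where "T \<omega> = (\<Sum>i\<in>A - insert k B. c i * W i \<omega>)" for \<omega>
    have "(\<lambda>\<omega>. \<Sum>i\<in>B. (W i \<omega>)\<^sup>2) \<in> borel_measurable M"
      using insert.prems W by (auto intro!: borel_measurable_sum)
    then have [measurable]: "S \<in> borel_measurable M"
      unfolding S_def by measurable
    have [measurable]: "T \<in> borel_measurable M"
      unfolding T_def using W by (auto intro!: borel_measurable_sum borel_measurable_times)
    have [measurable]: "W k \<in> borel_measurable M" using W insert.prems by auto
    have S01: "0 \<le> S \<omega>" "S \<omega> \<le> 1" for \<omega>
      using l by (auto simp: S_def sum_nonneg)
    define r where "r = sqrt (2 * l)"
    have r2: "r\<^sup>2 = 2 * l" using l by (simp add: r_def)
    have AB: "A - B = insert k (A - insert k B)" using insert by auto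
    have fA: "finite (A - insert k B)" "k \<notin> A - insert k B" using \<open>finite A\<close> by auto
    define D where "D = (\<Sum>i\<in>A - insert k B. (c i)\<^sup>2)"
    define q where "q = 1 / sqrt (1 + 2 * l)"
    let ?f = "\<lambda>x \<omega>. std_normal_density x * (S \<omega> * cos (r * x * W k \<omega> + T \<omega>))"
    \<comment> \<open>The cosine changes sign, so the exchange of integrals now needs integrability
      on the product space. Since \<open>S\<close> lies between 0 and 1, the normal density
      dominates.\<close>
    have "integrable (lborel \<Otimes>\<^sub>M M) (\<lambda>(x, \<omega>). std_normal_density x * 1)"
      by (intro integrableI_nonneg) (auto simp: nn_integral_fst[symmetric] case_prod_beta emeasure_space_1)
    then have int: "integrable (lborel \<Otimes>\<^sub>M M) (\<lambda>(x, \<omega>). ?f x \<omega>)"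
    proof (rule Bochner_Integration.integrable_bound)
      have "\<bar>?f x \<omega>\<bar> \<le> \<bar>std_normal_density x * 1\<bar>" for x \<omega>
      proof -
        have "\<bar>S \<omega> * cos (r * x * W k \<omega> + T \<omega>)\<bar> \<le> 1"
          using S01[of \<omega>] by (auto simp: abs_mult intro!: mult_le_one)
        then have "std_normal_density x * \<bar>S \<omega> * cos (r * x * W k \<omega> + T \<omega>)\<bar> \<le> std_normal_density x * 1"
          by (intro mult_left_mono) auto
        then show ?thesis by (simp add: abs_mult)
      qed
      then show "AE p in lborel \<Otimes>\<^sub>M M. norm (case p of (x, \<omega>) \<Rightarrow> ?f x \<omega>) \<le> norm (case p of (x, \<omega>) \<Rightarrow> std_normal_density x * 1)"
        by (auto simp del: mult_1_right)
    qed measurable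
    have "(\<integral>\<omega>. exp (- l * (\<Sum>i\<in>insert k B. (W i \<omega>)\<^sup>2)) * cos (\<Sum>i\<in>A - insert k B. c i * W i \<omega>) \<partial>M)
      = (\<integral>\<omega>. S \<omega> * (\<integral>x. std_normal_density x * cos (r * W k \<omega> * x + T \<omega>) \<partial>lborel) \<partial>M)"
      unfolding integral_std_normal_cos_shift using insert.hyps
      by (intro Bochner_Integration.integral_cong)
        (simp_all add: S_def T_def power_mult_distrib r2 exp_add[symmetric] algebra_simps)
    also have "\<dots> = (\<integral>\<omega>. (\<integral>x. ?f x \<omega> \<partial>lborel) \<partial>M)"
      by (intro Bochner_Integration.integral_cong refl, subst integral_mult_right_zero[symmetric])
        (simp_all add: mult_ac)
    also have "\<dots> = (\<integral>x. (\<integral>\<omega>. ?f x \<omega> \<partial>M) \<partial>lborel)"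
      using P.Fubini_integral[OF int] by simp
    also have "\<dots> = (\<integral>x. (q ^ card B * exp (- D / 2)) * (std_normal_density x * exp (- l * x\<^sup>2)) \<partial>lborel)"
    proof (intro Bochner_Integration.integral_cong refl)
      fix x
      have "(\<integral>\<omega>. S \<omega> * cos (r * x * W k \<omega> + T \<omega>) \<partial>M) =
        (\<integral>\<omega>. exp (- l * (\<Sum>i\<in>B. (W i \<omega>)\<^sup>2)) * cos (\<Sum>i\<in>A - B. (c(k := r * x)) i * W i \<omega>) \<partial>M)"
      proof -
        have "(\<Sum>i\<in>A - B. (c(k := r * x)) i * W i \<omega>) = r * x * W k \<omega> + T \<omega>" for \<omega>
          unfolding AB T_def using fA by (subst sum.insert) (auto intro!: sum.cong)
        then show ?thesis by (simp add: S_def)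
      qed
      also have "\<dots> = q ^ card B * exp (- (\<Sum>i\<in>A - B. ((c(k := r * x)) i)\<^sup>2) / 2)"
        unfolding q_def using insert.IH insert.prems by blast
      also have "(\<Sum>i\<in>A - B. ((c(k := r * x)) i)\<^sup>2) = 2 * l * x\<^sup>2 + D"
        unfolding AB using fA by (subst sum.insert) (auto intro!: sum.cong simp: D_def power_mult_distrib r2)
      also have "- (2 * l * x\<^sup>2 + D) / 2 = - D / 2 + - l * x\<^sup>2"
        by (simp add: field_simps)
      finally show "(\<integral>\<omega>. ?f x \<omega> \<partial>M) = (q ^ card B * exp (- D / 2)) * (std_normal_density x * exp (- l * x\<^sup>2))"
        by (simp add: mult_exp_exp)
    qed
    also have "\<dots> = (q ^ card B * exp (- D / 2)) * q"
      using l integral_std_normal_exp_square[of "- l"] by (simp add: q_def)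
    also have "\<dots> = q ^ card (insert k B) * exp (- D / 2)"
      using insert.hyps by simp
    finally show ?case by (simp add: q_def D_def)
  qed
qed

section \<open>Exponential tail bounds\<close>

text \<open>Chernoff's method: beyond the mean term, the logarithm of the Laplace transform costs at
  most \<open>4 l^2\<close> per variable. The deviation is scaled by \<open>n\<close> instead of
  \<open>card A\<close>, because the residue classes treated later are smaller than the sample while
  the errors are compared with \<open>n\<close>.\<close>

lemma std_gaussian_family_tail_upper:
  assumes "prob_space M" and fam: "std_gaussian_family M A W" and "finite A"
    and m: "card A \<le> n" and e: "0 < e" "e \<le> 1"
  shows "measure M {\<omega> \<in> space M. real (card A) + e * n \<le> (\<Sum>i\<in>A. (W i \<omega>)\<^sup>2)} \<le> exp (- (e\<^sup>2 / 16) * n)"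
proof -
  interpret prob_space M by fact
  have [measurable]: "W i \<in> borel_measurable M" if "i \<in> A" for i
    using fam that by (simp add: std_gaussian_family_def)
  have [measurable]: "(\<lambda>\<omega>. \<Sum>i\<in>A. (W i \<omega>)\<^sup>2) \<in> borel_measurable M"
    by (intro borel_measurable_sum) measurable
  let ?E = "{\<omega> \<in> space M. real (card A) + e * n \<le> (\<Sum>i\<in>A. (W i \<omega>)\<^sup>2)}"
  \<comment> \<open>The minimiser of \<open>4 l^2 - l e\<close>, with minimum
    \<open>- e^2 / 16\<close>; \<open>e \<le> 1\<close> keeps \<open>2 l\<close> in the range of the
    logarithm bound.\<close>
  define l where "l = e / 8"
  have l: "0 < l" "l \<le> 1 / 8" using e by (auto simp: l_def)
  have "ln (sqrt (1 - 2 * l)) = ln (1 - 2 * l) / 2"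
    using l by (simp add: ln_sqrt)
  moreover have "- (2 * l) - 2 * (2 * l)\<^sup>2 \<le> ln (1 - 2 * l)"
    using l ln_one_minus_pos_lower_bound[of "2 * l"] by simp
  ultimately have "- ln (sqrt (1 - 2 * l)) \<le> l + 4 * l\<^sup>2"
    by (simp add: power_mult_distrib field_simps)
  moreover have "1 / sqrt (1 - 2 * l) = exp (- ln (sqrt (1 - 2 * l)))"
    using l by (simp add: exp_minus field_simps)
  ultimately have b: "1 / sqrt (1 - 2 * l) \<le> exp (l + 4 * l\<^sup>2)" by simp
  have "emeasure M ?E \<le> ennreal (exp (- l * (real (card A) + e * n))) *
      (\<integral>\<^sup>+\<omega>. ennreal (exp (l * (\<Sum>i\<in>A. (W i \<omega>)\<^sup>2))) * indicator (space M) \<omega> \<partial>M)"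
    using l by (intro Chernoff_ineq_nn_integral_ge) auto
  also have "(\<integral>\<^sup>+\<omega>. ennreal (exp (l * (\<Sum>i\<in>A. (W i \<omega>)\<^sup>2))) * indicator (space M) \<omega> \<partial>M) =
      (\<integral>\<^sup>+\<omega>. ennreal (exp (l * (\<Sum>i\<in>A. (W i \<omega>)\<^sup>2))) \<partial>M)"
    by (intro nn_integral_cong) auto
  also have "\<dots> = ennreal ((1 / sqrt (1 - 2 * l)) ^ card A)"
    using std_gaussian_family_exp_sum_squares[OF \<open>prob_space M\<close> fam \<open>finite A\<close> subset_refl, of l "\<lambda>_. 0"] l by simp
  also have "ennreal (exp (- l * (real (card A) + e * n))) * \<dots> \<le> ennreal (exp (- (e\<^sup>2 / 16) * n))"
  proof -
    have "(1 / sqrt (1 - 2 * l)) ^ card A \<le> exp (card A * (l + 4 * l\<^sup>2))"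
      using power_mono[OF b, of "card A"] l by (simp add: exp_of_nat_mult)
    then have "exp (- l * (real (card A) + e * n)) * (1 / sqrt (1 - 2 * l)) ^ card A \<le>
        exp (- l * (real (card A) + e * n)) * exp (card A * (l + 4 * l\<^sup>2))"
      by simp
    also have "\<dots> = exp (card A * (4 * l\<^sup>2) - l * e * n)"
      by (simp add: mult_exp_exp algebra_simps)
    also have "\<dots> \<le> exp (n * (4 * l\<^sup>2) - l * e * n)"
      using m by (simp add: mult_right_mono)
    also have "\<dots> = exp (- (e\<^sup>2 / 16) * n)"
      by (simp add: l_def power2_eq_square field_simps)
    finally show ?thesis by (subst ennreal_mult'[symmetric]) (auto intro: ennreal_leI)
  qed
  finally show ?thesis by (simp add: emeasure_eq_measure)
qed

text \<open>The exponent at \<open>- l\<close> has the same quadratic bound as in the upper tail, so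
  the rate agrees. The transform is used with all variables squared, where the remaining cosine is
  \<open>cos 0 = 1\<close>.\<close>

lemma std_gaussian_family_tail_lower:
  assumes "prob_space M" and fam: "std_gaussian_family M A W" and "finite A"
    and m: "card A \<le> n" and e: "0 < e" "e \<le> 1"
  shows "measure M {\<omega> \<in> space M. (\<Sum>i\<in>A. (W i \<omega>)\<^sup>2) \<le> real (card A) - e * n} \<le> exp (- (e\<^sup>2 / 16) * n)"
proof -
  interpret prob_space M by fact
  have [measurable]: "W i \<in> borel_measurable M" if "i \<in> A" for i
    using fam that by (simp add: std_gaussian_family_def)
  have [measurable]: "(\<lambda>\<omega>. \<Sum>i\<in>A. (W i \<omega>)\<^sup>2) \<in> borel_measurable M"
    by (intro borel_measurable_sum) measurable
  let ?E = "{\<omega> \<in> space M. (\<Sum>i\<in>A. (W i \<omega>)\<^sup>2) \<le> real (card A) - e * n}"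
  define l where "l = e / 8"
  have l: "0 < l" "l \<le> 1 / 8" using e by (auto simp: l_def)
  have "ln (sqrt (1 + 2 * l)) = ln (1 + 2 * l) / 2"
    using l by (simp add: ln_sqrt)
  moreover have "2 * l - (2 * l)\<^sup>2 \<le> ln (1 + 2 * l)"
    using l ln_one_plus_pos_lower_bound[of "2 * l"] by simp
  moreover have "(2 * l)\<^sup>2 = 4 * l\<^sup>2" by (simp add: power_mult_distrib)
  ultimately have "- ln (sqrt (1 + 2 * l)) \<le> - l + 4 * l\<^sup>2"
    using zero_le_power2[of l] by linarith
  moreover have "1 / sqrt (1 + 2 * l) = exp (- ln (sqrt (1 + 2 * l)))"
    using l by (simp add: exp_minus field_simps)
  ultimately have b: "1 / sqrt (1 + 2 * l) \<le> exp (- l + 4 * l\<^sup>2)" by simp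
  have "emeasure M ?E \<le> ennreal (exp (l * (real (card A) - e * n))) *
      (\<integral>\<^sup>+\<omega>. ennreal (exp (- l * (\<Sum>i\<in>A. (W i \<omega>)\<^sup>2))) * indicator (space M) \<omega> \<partial>M)"
    using l by (intro Chernoff_ineq_nn_integral_le) auto
  also have "(\<integral>\<^sup>+\<omega>. ennreal (exp (- l * (\<Sum>i\<in>A. (W i \<omega>)\<^sup>2))) * indicator (space M) \<omega> \<partial>M) =
      (\<integral>\<^sup>+\<omega>. ennreal (exp (- l * (\<Sum>i\<in>A. (W i \<omega>)\<^sup>2))) \<partial>M)"
    by (intro nn_integral_cong) auto
  also have "\<dots> = ennreal (\<integral>\<omega>. exp (- l * (\<Sum>i\<in>A. (W i \<omega>)\<^sup>2)) \<partial>M)"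
    using l by (intro nn_integral_eq_integral integrable_const_bound[where B = 1])
      (auto simp: sum_nonneg)
  also have "(\<integral>\<omega>. exp (- l * (\<Sum>i\<in>A. (W i \<omega>)\<^sup>2)) \<partial>M) = (1 / sqrt (1 + 2 * l)) ^ card A"
    using std_gaussian_family_exp_neg_sum_squares[OF \<open>prob_space M\<close> fam \<open>finite A\<close> subset_refl, of l "\<lambda>_. 0"] l by simp
  also have "ennreal (exp (l * (real (card A) - e * n))) * \<dots> \<le> ennreal (exp (- (e\<^sup>2 / 16) * n))"
  proof -
    have "(1 / sqrt (1 + 2 * l)) ^ card A \<le> exp (card A * (- l + 4 * l\<^sup>2))"
      using power_mono[OF b, of "card A"] l by (simp add: exp_of_nat_mult)
    then have "exp (l * (real (card A) - e * n)) * (1 / sqrt (1 + 2 * l)) ^ card A \<le>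
        exp (l * (real (card A) - e * n)) * exp (card A * (- l + 4 * l\<^sup>2))"
      by simp
    also have "\<dots> = exp (card A * (4 * l\<^sup>2) - l * e * n)"
      by (simp add: mult_exp_exp algebra_simps)
    also have "\<dots> \<le> exp (n * (4 * l\<^sup>2) - l * e * n)"
      using m by (simp add: mult_right_mono)
    also have "\<dots> = exp (- (e\<^sup>2 / 16) * n)"
      by (simp add: l_def power2_eq_square field_simps)
    finally show ?thesis by (subst ennreal_mult'[symmetric]) (auto intro: ennreal_leI)
  qed
  finally show ?thesis by (simp add: emeasure_eq_measure)
qed

section \<open>From Gaussian processes to orthonormal families\<close>

lemma gaussian_rv_integrable:
  assumes "prob_space M" and "gaussian_rv M X"
  shows "integrable M X" and "integrable M (\<lambda>\<omega>. (X \<omega>)\<^sup>2)"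
proof -
  interpret prob_space M by fact
  have [measurable]: "X \<in> borel_measurable M" using assms(2) by (simp add: gaussian_rv_def)
  consider \<mu> where "AE \<omega> in M. X \<omega> = \<mu>"
    | \<mu> \<sigma> where "\<sigma> > 0" "distributed M lborel X (normal_density \<mu> \<sigma>)"
    using assms(2) by (auto simp: gaussian_rv_def)
  then have "integrable M X \<and> integrable M (\<lambda>\<omega>. (X \<omega>)\<^sup>2)"
  proof cases
    case 1
    have "integrable M X \<longleftrightarrow> integrable M (\<lambda>_. \<mu>)"
      using 1 by (intro integrable_cong_AE) auto
    moreover have "integrable M (\<lambda>\<omega>. (X \<omega>)\<^sup>2) \<longleftrightarrow> integrable M (\<lambda>_. \<mu>\<^sup>2)"
      using 1 by (intro integrable_cong_AE) auto
    ultimately show ?thesis by simp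
  next
    case 2
    have i: "integrable M (\<lambda>\<omega>. (X \<omega> - \<mu>) ^ k)" for k
      using distributed_integrable[OF 2(2), of "\<lambda>x. (x - \<mu>) ^ k"] integrable_normal_moment[OF 2(1)] by simp
    have "integrable M (\<lambda>\<omega>. (X \<omega> - \<mu>) ^ 1 + \<mu>)"
      using i[of 1] by (intro Bochner_Integration.integrable_add) auto
    moreover have "integrable M (\<lambda>\<omega>. (X \<omega> - \<mu>) ^ 2 + (2 * \<mu> * (X \<omega> - \<mu>) ^ 1 + \<mu>\<^sup>2))"
      using i[of 1] i[of 2] by (intro Bochner_Integration.integrable_add integrable_mult_right) auto
    moreover have "(x - \<mu>) ^ 2 + (2 * \<mu> * (x - \<mu>) ^ 1 + \<mu>\<^sup>2) = x\<^sup>2" for x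
      by (simp add: power2_eq_square algebra_simps)
    ultimately show ?thesis by simp
  qed
  then show "integrable M X" "integrable M (\<lambda>\<omega>. (X \<omega>)\<^sup>2)" by auto
qed

text \<open>Expressing both transforms through the second moment gives one formula for the
  degenerate and the non-degenerate case.\<close>

lemma centered_gaussian_rv_exp_cos:
  assumes "prob_space M" and X: "gaussian_rv M X" and mean: "(\<integral>\<omega>. X \<omega> \<partial>M) = 0"
  shows "(\<integral>\<^sup>+\<omega>. ennreal (exp (X \<omega>)) \<partial>M) = ennreal (exp ((\<integral>\<omega>. (X \<omega>)\<^sup>2 \<partial>M) / 2))"
    and "(\<integral>\<omega>. cos (X \<omega>) \<partial>M) = exp (- (\<integral>\<omega>. (X \<omega>)\<^sup>2 \<partial>M) / 2)"
proof -
  interpret prob_space M by fact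
  have [measurable]: "X \<in> borel_measurable M" using X by (simp add: gaussian_rv_def)
  consider \<mu> where "AE \<omega> in M. X \<omega> = \<mu>"
    | \<mu> \<sigma> where "\<sigma> > 0" "distributed M lborel X (normal_density \<mu> \<sigma>)"
    using X by (auto simp: gaussian_rv_def)
  then have "(\<integral>\<^sup>+\<omega>. ennreal (exp (X \<omega>)) \<partial>M) = ennreal (exp ((\<integral>\<omega>. (X \<omega>)\<^sup>2 \<partial>M) / 2)) \<and>
    (\<integral>\<omega>. cos (X \<omega>) \<partial>M) = exp (- (\<integral>\<omega>. (X \<omega>)\<^sup>2 \<partial>M) / 2)"
  proof cases
    case 1
    have "(\<integral>\<omega>. X \<omega> \<partial>M) = (\<integral>\<omega>. \<mu> \<partial>M)"
      using 1 by (intro integral_cong_AE) auto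
    then have "\<mu> = 0" using mean prob_space by simp
    then have 0: "AE \<omega> in M. X \<omega> = 0" using 1 by simp
    have "(\<integral>\<omega>. (X \<omega>)\<^sup>2 \<partial>M) = (\<integral>\<omega>. 0 \<partial>M)"
      using 0 by (intro integral_cong_AE) auto
    moreover have "(\<integral>\<omega>. cos (X \<omega>) \<partial>M) = (\<integral>\<omega>. 1 \<partial>M)"
      using 0 by (intro integral_cong_AE) auto
    moreover have "(\<integral>\<^sup>+\<omega>. ennreal (exp (X \<omega>)) \<partial>M) = (\<integral>\<^sup>+\<omega>. 1 \<partial>M)"
      using 0 by (intro nn_integral_cong_AE) auto
    ultimately show ?thesis by (simp add: emeasure_space_1 prob_space)
  next
    case 2
    have "\<mu> = 0" using normal_distributed_expectation[OF 2] mean by simp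
    then have D: "distributed M lborel X (normal_density 0 \<sigma>)" using 2 by simp
    have var: "(\<integral>\<omega>. (X \<omega>)\<^sup>2 \<partial>M) = \<sigma>\<^sup>2"
      using normal_distributed_variance[OF 2] mean by simp
    have "(\<integral>\<^sup>+\<omega>. ennreal (exp (X \<omega>)) \<partial>M) = (\<integral>\<^sup>+x. ennreal (normal_density 0 \<sigma> x) * ennreal (exp (1 * x)) \<partial>lborel)"
      using distributed_nn_integral[OF D, of "\<lambda>x. ennreal (exp x)"] by simp
    also have "\<dots> = (\<integral>\<^sup>+x. ennreal (exp (\<sigma>\<^sup>2 / 2)) * ennreal (normal_density (1 * \<sigma>\<^sup>2) \<sigma> x) \<partial>lborel)"
      by (simp only: ennreal_mult''[symmetric] ennreal_mult'[symmetric] exp_ge_zero normal_density_nonneg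
          normal_density_times_exp[OF 2(1)]) simp
    also have "\<dots> = ennreal (exp (\<sigma>\<^sup>2 / 2))"
      using 2(1) by (subst nn_integral_cmult) auto
    finally have e: "(\<integral>\<^sup>+\<omega>. ennreal (exp (X \<omega>)) \<partial>M) = ennreal (exp (\<sigma>\<^sup>2 / 2))" .
    have "distributed M lborel (\<lambda>\<omega>. (X \<omega> - 0) / \<sigma>) std_normal_density"
      using normal_standard_normal_convert[OF 2(1)] D by blast
    then have "(\<integral>\<omega>. cos (\<sigma> * ((X \<omega> - 0) / \<sigma>)) \<partial>M) = (\<integral>x. std_normal_density x * cos (\<sigma> * x) \<partial>lborel)"
      by (subst distributed_integral[symmetric]) auto
    then have "(\<integral>\<omega>. cos (X \<omega>) \<partial>M) = exp (- \<sigma>\<^sup>2 / 2)"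
      using 2(1) by (simp add: integral_std_normal_cos_sin)
    with e var show ?thesis by simp
  qed
  then show "(\<integral>\<^sup>+\<omega>. ennreal (exp (X \<omega>)) \<partial>M) = ennreal (exp ((\<integral>\<omega>. (X \<omega>)\<^sup>2 \<partial>M) / 2))"
    and "(\<integral>\<omega>. cos (X \<omega>) \<partial>M) = exp (- (\<integral>\<omega>. (X \<omega>)\<^sup>2 \<partial>M) / 2)" by auto
qed

lemma integrable_mult_of_integrable_squares:
  fixes X Y :: "'a \<Rightarrow> real"
  assumes "X \<in> borel_measurable M" "Y \<in> borel_measurable M"
    and "integrable M (\<lambda>\<omega>. (X \<omega>)\<^sup>2)" "integrable M (\<lambda>\<omega>. (Y \<omega>)\<^sup>2)"
  shows "integrable M (\<lambda>\<omega>. X \<omega> * Y \<omega>)"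
proof (rule Bochner_Integration.integrable_bound)
  show "integrable M (\<lambda>\<omega>. (X \<omega>)\<^sup>2 + (Y \<omega>)\<^sup>2)" using assms by auto
  have "\<bar>x * y\<bar> \<le> x\<^sup>2 + y\<^sup>2" for x y :: real
  proof -
    have "2 * \<bar>x * y\<bar> \<le> x\<^sup>2 + y\<^sup>2"
      using sum_squares_bound[of "\<bar>x\<bar>" "\<bar>y\<bar>"] by (simp add: abs_mult mult.assoc)
    then show ?thesis by linarith
  qed
  then show "AE \<omega> in M. norm (X \<omega> * Y \<omega>) \<le> norm ((X \<omega>)\<^sup>2 + (Y \<omega>)\<^sup>2)"
    by (simp add: abs_of_nonneg)
qed (use assms in auto)

text \<open>Innovations share time points, whereas \<open>gaussian_process\<close> speaks of sums
  over sets of distinct points. The closure properties of this space merge repeated points.\<close>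

definition lin_combs :: "'t set \<Rightarrow> ('t \<Rightarrow> 'a \<Rightarrow> real) \<Rightarrow> ('a \<Rightarrow> real) set" where
  "lin_combs T Z = {X. \<exists>F c. finite F \<and> F \<subseteq> T \<and> X = (\<lambda>\<omega>. \<Sum>t\<in>F. c t * Z t \<omega>)}"

lemma lin_combs_base: "t \<in> T \<Longrightarrow> Z t \<in> lin_combs T Z"
  unfolding lin_combs_def by (auto intro!: exI[of _ "{t}"] exI[of _ "\<lambda>_. 1"])

lemma lin_combs_zero: "(\<lambda>_. 0) \<in> lin_combs T Z"
  unfolding lin_combs_def by (auto intro!: exI[of _ "{}"])

lemma lin_combs_scale:
  assumes "X \<in> lin_combs T Z"
  shows "(\<lambda>\<omega>. r * X \<omega>) \<in> lin_combs T Z"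
proof -
  obtain F c where "finite F" "F \<subseteq> T" "X = (\<lambda>\<omega>. \<Sum>t\<in>F. c t * Z t \<omega>)"
    using assms by (auto simp: lin_combs_def)
  then show ?thesis
    unfolding lin_combs_def
    by (auto intro!: exI[of _ F] exI[of _ "\<lambda>t. r * c t"] simp: sum_distrib_left mult.assoc)
qed

lemma lin_combs_add:
  assumes "X \<in> lin_combs T Z" "Y \<in> lin_combs T Z"
  shows "(\<lambda>\<omega>. X \<omega> + Y \<omega>) \<in> lin_combs T Z"
proof -
  obtain F c where F: "finite F" "F \<subseteq> T" "X = (\<lambda>\<omega>. \<Sum>t\<in>F. c t * Z t \<omega>)"
    using assms(1) by (auto simp: lin_combs_def)
  obtain G d where G: "finite G" "G \<subseteq> T" "Y = (\<lambda>\<omega>. \<Sum>t\<in>G. d t * Z t \<omega>)"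
    using assms(2) by (auto simp: lin_combs_def)
  define e where "e t = (if t \<in> F then c t else 0) + (if t \<in> G then d t else 0)" for t
  have "X \<omega> = (\<Sum>t\<in>F \<union> G. (if t \<in> F then c t else 0) * Z t \<omega>)" for \<omega>
    unfolding F using F(1) G(1) by (intro sum.mono_neutral_cong_left) auto
  moreover have "Y \<omega> = (\<Sum>t\<in>F \<union> G. (if t \<in> G then d t else 0) * Z t \<omega>)" for \<omega>
    unfolding G using F(1) G(1) by (intro sum.mono_neutral_cong_left) auto
  ultimately have "X \<omega> + Y \<omega> = (\<Sum>t\<in>F \<union> G. e t * Z t \<omega>)" for \<omega>
    by (simp add: e_def sum.distrib[symmetric] distrib_right)
  then show ?thesis
    unfolding lin_combs_def using F G by (auto intro!: exI[of _ "F \<union> G"] exI[of _ e])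
qed

lemma lin_combs_sum:
  assumes "finite A" "\<And>i. i \<in> A \<Longrightarrow> X i \<in> lin_combs T Z"
  shows "(\<lambda>\<omega>. \<Sum>i\<in>A. X i \<omega>) \<in> lin_combs T Z"
  using assms by (induction A rule: finite_induct) (auto intro: lin_combs_add lin_combs_zero)

lemma lin_combs_gaussian_rv:
  "gaussian_process M T Z \<Longrightarrow> X \<in> lin_combs T Z \<Longrightarrow> gaussian_rv M X"
  by (auto simp: gaussian_process_def lin_combs_def)

lemma lin_combs_mean_zero:
  assumes "prob_space M" "gaussian_process M T Z" "\<And>t. t \<in> T \<Longrightarrow> (\<integral>\<omega>. Z t \<omega> \<partial>M) = 0"
    and "X \<in> lin_combs T Z"
  shows "(\<integral>\<omega>. X \<omega> \<partial>M) = 0"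
proof -
  obtain F c where F: "finite F" "F \<subseteq> T" "X = (\<lambda>\<omega>. \<Sum>t\<in>F. c t * Z t \<omega>)"
    using assms(4) by (auto simp: lin_combs_def)
  have "integrable M (Z t)" if "t \<in> F" for t
    using gaussian_rv_integrable(1)[OF assms(1) lin_combs_gaussian_rv[OF assms(2) lin_combs_base]] that F(2) by auto
  then show ?thesis
    unfolding F(3) using F(2) assms(3) by (subst Bochner_Integration.integral_sum) (auto intro!: sum.neutral)
qed

text \<open>Every linear combination of the \<open>W i\<close> is again a centred Gaussian variable,
  so its transforms depend only on its variance, and orthonormality makes that variance the sum of
  the squared coefficients.\<close>

lemma std_gaussian_familyI:
  assumes M: "prob_space M" and Z: "gaussian_process M T Z" "\<And>t. t \<in> T \<Longrightarrow> (\<integral>\<omega>. Z t \<omega> \<partial>M) = 0"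
    and "finite A" and W: "\<And>i. i \<in> A \<Longrightarrow> W i \<in> lin_combs T Z"
    and orth: "\<And>i j. i \<in> A \<Longrightarrow> j \<in> A \<Longrightarrow> (\<integral>\<omega>. W i \<omega> * W j \<omega> \<partial>M) = (if i = j then 1 else 0)"
  shows "std_gaussian_family M A W"
proof -
  have g: "gaussian_rv M (W i)" if "i \<in> A" for i
    using W Z(1) lin_combs_gaussian_rv that by blast
  have meas: "W i \<in> borel_measurable M" if "i \<in> A" for i
    using g[OF that] by (simp add: gaussian_rv_def)
  have int: "integrable M (\<lambda>\<omega>. W i \<omega> * W j \<omega>)" if "i \<in> A" "j \<in> A" for i j
    using g gaussian_rv_integrable(2)[OF M] meas that
    by (intro integrable_mult_of_integrable_squares) auto
  have *: "(\<integral>\<omega>. (\<Sum>i\<in>A. c i * W i \<omega>)\<^sup>2 \<partial>M) = (\<Sum>i\<in>A. (c i)\<^sup>2)" for c :: "'c \<Rightarrow> real"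
  proof -
    have "(\<Sum>i\<in>A. c i * W i \<omega>)\<^sup>2 = (\<Sum>i\<in>A. \<Sum>j\<in>A. c i * c j * (W i \<omega> * W j \<omega>))" for \<omega>
      by (simp add: power2_eq_square sum_product mult_ac)
    then have "(\<integral>\<omega>. (\<Sum>i\<in>A. c i * W i \<omega>)\<^sup>2 \<partial>M) = (\<Sum>i\<in>A. \<Sum>j\<in>A. c i * c j * (\<integral>\<omega>. W i \<omega> * W j \<omega> \<partial>M))"
      using int by (simp add: Bochner_Integration.integral_sum)
    also have "\<dots> = (\<Sum>i\<in>A. \<Sum>j\<in>A. if i = j then c i * c j else 0)"
      by (intro sum.cong) (auto simp: orth)
    finally show ?thesis using \<open>finite A\<close> by (simp add: power2_eq_square)
  qed
  have lc: "(\<lambda>\<omega>. \<Sum>i\<in>A. c i * W i \<omega>) \<in> lin_combs T Z" for c :: "'c \<Rightarrow> real"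
    using \<open>finite A\<close> W by (intro lin_combs_sum lin_combs_scale) auto
  note ec = centered_gaussian_rv_exp_cos[OF M lin_combs_gaussian_rv[OF Z(1) lc] lin_combs_mean_zero[OF M Z lc], unfolded *]
  show ?thesis
    unfolding std_gaussian_family_def using meas ec by blast
qed

section \<open>Strong law for the innovations of the Ornstein-Uhlenbeck process\<close>

text \<open>The error in predicting \<open>z t\<close> from \<open>z s\<close>, divided by its
  conditional standard deviation; meant for \<open>s < t\<close>.\<close>

definition innov :: "real \<Rightarrow> real \<Rightarrow> (real \<Rightarrow> real) \<Rightarrow> real \<Rightarrow> real \<Rightarrow> real" where
  "innov \<theta> v z s t = (z t - exp (- \<theta> * (t - s)) * z s) / sqrt (v * (1 - exp (- 2 * \<theta> * (t - s))))"

lemma OU_process_product_moment: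
  assumes OU: "OU_process M Z \<theta> v" and st: "s \<in> {0..1}" "t \<in> {0..1}"
  shows "integrable M (\<lambda>\<omega>. Z s \<omega> * Z t \<omega>)"
    and "(\<integral>\<omega>. Z s \<omega> * Z t \<omega> \<partial>M) = v * exp (- \<theta> * \<bar>s - t\<bar>)"
proof -
  have M: "prob_space M" and gp: "gaussian_process M {0..1} Z"
    using OU by (auto simp: OU_process_def)
  have g: "gaussian_rv M (Z u)" if "u \<in> {0..1}" for u
    using lin_combs_gaussian_rv[OF gp lin_combs_base[OF that]] .
  show "integrable M (\<lambda>\<omega>. Z s \<omega> * Z t \<omega>)"
    using g gaussian_rv_integrable(2)[OF M] st
    by (intro integrable_mult_of_integrable_squares) (auto simp: gaussian_rv_def)
  have "covariance M (Z s) (Z t) = v * exp (- \<theta> * \<bar>s - t\<bar>)"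
    "integral\<^sup>L M (Z s) = 0" "integral\<^sup>L M (Z t) = 0"
    using OU st by (auto simp: OU_process_def)
  then show "(\<integral>\<omega>. Z s \<omega> * Z t \<omega> \<partial>M) = v * exp (- \<theta> * \<bar>s - t\<bar>)"
    by (simp add: covariance_def)
qed

text \<open>No order of the four points is fixed yet, so that orthogonality and unit variance both
  follow by specialisation.\<close>

lemma innov_product_moment:
  assumes OU: "OU_process M Z \<theta> v" and "s \<in> {0..1}" "t \<in> {0..1}" "s' \<in> {0..1}" "t' \<in> {0..1}"
  shows "(\<integral>\<omega>. innov \<theta> v (\<lambda>t. Z t \<omega>) s t * innov \<theta> v (\<lambda>t. Z t \<omega>) s' t' \<partial>M) =
     v * (exp (- \<theta> * \<bar>t - t'\<bar>) - exp (- \<theta> * (t' - s')) * exp (- \<theta> * \<bar>t - s'\<bar>)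
       - exp (- \<theta> * (t - s)) * exp (- \<theta> * \<bar>s - t'\<bar>)
       + exp (- \<theta> * (t - s)) * exp (- \<theta> * (t' - s')) * exp (- \<theta> * \<bar>s - s'\<bar>))
     / (sqrt (v * (1 - exp (- 2 * \<theta> * (t - s)))) * sqrt (v * (1 - exp (- 2 * \<theta> * (t' - s')))))"
proof -
  note mom = OU_process_product_moment[OF OU]
  define p where "p = exp (- \<theta> * (t - s))"
  define p' where "p' = exp (- \<theta> * (t' - s'))"
  define D where "D = sqrt (v * (1 - exp (- 2 * \<theta> * (t - s)))) * sqrt (v * (1 - exp (- 2 * \<theta> * (t' - s'))))"
  have "innov \<theta> v (\<lambda>t. Z t \<omega>) s t * innov \<theta> v (\<lambda>t. Z t \<omega>) s' t' =
      (Z t \<omega> * Z t' \<omega> - p' * (Z t \<omega> * Z s' \<omega>) - p * (Z s \<omega> * Z t' \<omega>) + p * p' * (Z s \<omega> * Z s' \<omega>)) / D" for \<omega>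
    unfolding innov_def p_def[symmetric] p'_def[symmetric] D_def times_divide_times_eq
    by (rule arg_cong2[where f = "(/)"]) (simp_all add: algebra_simps)
  then have "(\<integral>\<omega>. innov \<theta> v (\<lambda>t. Z t \<omega>) s t * innov \<theta> v (\<lambda>t. Z t \<omega>) s' t' \<partial>M) =
     (v * exp (- \<theta> * \<bar>t - t'\<bar>) - p' * (v * exp (- \<theta> * \<bar>t - s'\<bar>))
       - p * (v * exp (- \<theta> * \<bar>s - t'\<bar>)) + p * p' * (v * exp (- \<theta> * \<bar>s - s'\<bar>))) / D"
    using assms(2-5) by (simp add: mom)
  then show ?thesis
    by (simp add: D_def p_def p'_def algebra_simps)
qed

text \<open>This is the Markov property: for \<open>u \<le> s'\<close> the covariance of
  \<open>Z u\<close> and \<open>Z t'\<close> factors through \<open>s'\<close>, so the innovation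
  from \<open>s'\<close> to \<open>t'\<close> is orthogonal to both \<open>Z s\<close> and
  \<open>Z t\<close>.\<close>

lemma innov_orthogonal:
  assumes OU: "OU_process M Z \<theta> v" and "0 \<le> s" "s < t" "t \<le> s'" "s' < t'" "t' \<le> 1"
  shows "(\<integral>\<omega>. innov \<theta> v (\<lambda>t. Z t \<omega>) s t * innov \<theta> v (\<lambda>t. Z t \<omega>) s' t' \<partial>M) = 0"
proof -
  have *: "\<bar>t - t'\<bar> = t' - t" "\<bar>t - s'\<bar> = s' - t" "\<bar>s - t'\<bar> = t' - s" "\<bar>s - s'\<bar> = s' - s"
    using assms by auto
  have "exp (- \<theta> * (t' - t)) = exp (- \<theta> * (t' - s')) * exp (- \<theta> * (s' - t))"
    by (simp add: mult_exp_exp algebra_simps)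
  moreover have "exp (- \<theta> * (t - s)) * exp (- \<theta> * (t' - s)) =
      exp (- \<theta> * (t - s)) * exp (- \<theta> * (t' - s')) * exp (- \<theta> * (s' - s))"
    by (simp add: mult_exp_exp algebra_simps)
  ultimately show ?thesis
    using assms by (subst innov_product_moment[OF OU]) (auto simp: *)
qed

lemma innov_unit_variance:
  assumes OU: "OU_process M Z \<theta> v" and "0 < \<theta>" "0 < v" "0 \<le> s" "s < t" "t \<le> 1"
  shows "(\<integral>\<omega>. innov \<theta> v (\<lambda>t. Z t \<omega>) s t * innov \<theta> v (\<lambda>t. Z t \<omega>) s t \<partial>M) = 1"
proof -
  have *: "\<bar>t - t\<bar> = 0" "\<bar>t - s\<bar> = t - s" "\<bar>s - t\<bar> = t - s" "\<bar>s - s\<bar> = 0"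
    using assms by auto
  have "exp (- 2 * \<theta> * (t - s)) < 1" using assms by simp
  then have "v * (1 - exp (- 2 * \<theta> * (t - s))) > 0" using assms by simp
  moreover have "exp (- \<theta> * (t - s)) * exp (- \<theta> * (t - s)) = exp (- 2 * \<theta> * (t - s))"
    by (simp add: mult_exp_exp algebra_simps)
  ultimately show ?thesis
    using assms by (subst innov_product_moment[OF OU]) (auto simp only: * real_sqrt_mult_self, auto simp: algebra_simps)
qed

text \<open>The inequality in \<open>disj\<close> is weak because neighbouring members of a residue
  class share an endpoint: the interval from \<open>i\<close> to \<open>i + k\<close> is followed by
  the one from \<open>i + k\<close> to \<open>i + 2 k\<close>.\<close>

lemma innov_std_gaussian_family:
  fixes \<sigma> \<tau> :: "nat \<Rightarrow> real"
  assumes OU: "OU_process M Z \<theta> v" and "0 < \<theta>" "0 < v" and "finite A"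
    and st: "\<And>i. i \<in> A \<Longrightarrow> 0 \<le> \<sigma> i \<and> \<sigma> i < \<tau> i \<and> \<tau> i \<le> 1"
    and disj: "\<And>i j. i \<in> A \<Longrightarrow> j \<in> A \<Longrightarrow> i < j \<Longrightarrow> \<tau> i \<le> \<sigma> j"
  shows "std_gaussian_family M A (\<lambda>i \<omega>. innov \<theta> v (\<lambda>t. Z t \<omega>) (\<sigma> i) (\<tau> i))"
proof (rule std_gaussian_familyI[where T = "{0..1}" and Z = Z])
  show "prob_space M" "gaussian_process M {0..1} Z" "\<And>t. t \<in> {0..1} \<Longrightarrow> (\<integral>\<omega>. Z t \<omega> \<partial>M) = 0"
    using OU by (auto simp: OU_process_def)
  show "(\<lambda>\<omega>. innov \<theta> v (\<lambda>t. Z t \<omega>) (\<sigma> i) (\<tau> i)) \<in> lin_combs {0..1} Z" if "i \<in> A" for i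
  proof -
    define D where "D = 1 / sqrt (v * (1 - exp (- 2 * \<theta> * (\<tau> i - \<sigma> i))))"
    have "innov \<theta> v (\<lambda>t. Z t \<omega>) (\<sigma> i) (\<tau> i) = D * (Z (\<tau> i) \<omega> + (- exp (- \<theta> * (\<tau> i - \<sigma> i))) * Z (\<sigma> i) \<omega>)" for \<omega>
      by (simp add: innov_def D_def)
    then show ?thesis
      using st[OF that] by (simp only:) (intro lin_combs_scale lin_combs_add lin_combs_base; simp)
  qed
  show "(\<integral>\<omega>. innov \<theta> v (\<lambda>t. Z t \<omega>) (\<sigma> i) (\<tau> i) * innov \<theta> v (\<lambda>t. Z t \<omega>) (\<sigma> j) (\<tau> j) \<partial>M) =
      (if i = j then 1 else 0)" if "i \<in> A" "j \<in> A" for i j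
  proof -
    consider "i = j" | "i < j" | "j < i" by linarith
    then show ?thesis
    proof cases
      case 1
      then show ?thesis using innov_unit_variance[OF OU] assms(2,3) st that by auto
    next
      case 2
      then show ?thesis using innov_orthogonal[OF OU] disj st that by auto
    next
      case 3
      then show ?thesis using innov_orthogonal[OF OU, of "\<sigma> j" "\<tau> j" "\<sigma> i" "\<tau> i"] disj st that
        by (auto simp: mult.commute)
    qed
  qed
qed fact

section \<open>Strong law along the triangular array\<close>

text \<open>Nothing links the families for different \<open>n\<close>: the first Borel-Cantelli
  lemma only needs the two tail probabilities to be summable, and they are dominated by a geometric
  series.\<close>

lemma std_gaussian_family_borel_cantelli:
  fixes A :: "nat \<Rightarrow> 'i set" and W :: "nat \<Rightarrow> 'i \<Rightarrow> 'a \<Rightarrow> real" and e :: real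
  assumes M: "prob_space M" and fam: "\<And>n. std_gaussian_family M (A n) (W n)"
    and fin: "\<And>n. finite (A n)" and card: "\<And>n. card (A n) \<le> n" and e: "0 < e" "e \<le> 1"
  shows "AE \<omega> in M. \<forall>\<^sub>F n in sequentially. \<bar>(\<Sum>i\<in>A n. (W n i \<omega>)\<^sup>2) - card (A n)\<bar> < e * n"
proof -
  interpret prob_space M by fact
  let ?S = "\<lambda>n \<omega>. \<Sum>i\<in>A n. (W n i \<omega>)\<^sup>2"
  have [measurable]: "?S n \<in> borel_measurable M" for n
  proof -
    have "W n i \<in> borel_measurable M" if "i \<in> A n" for i
      using fam[of n] that by (simp add: std_gaussian_family_def)
    then show ?thesis by (intro borel_measurable_sum) measurable
  qed
  have sm: "summable (\<lambda>n. exp (- (e\<^sup>2 / 16) * real n))"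
  proof -
    have "summable (\<lambda>n. exp (- (e\<^sup>2 / 16)) ^ n)"
      using e by (intro summable_geometric) simp
    then show ?thesis by (simp add: exp_of_nat_mult[symmetric] mult.commute)
  qed
  define U where "U n = {\<omega> \<in> space M. real (card (A n)) + e * n \<le> ?S n \<omega>}" for n
  define L where "L n = {\<omega> \<in> space M. ?S n \<omega> \<le> real (card (A n)) - e * n}" for n
  have "AE \<omega> in M. \<forall>\<^sub>F n in sequentially. \<omega> \<in> space M - U n"
  proof (rule borel_cantelli_AE1)
    show "summable (\<lambda>n. prob (U n))"
    proof (rule summable_comparison_test'[OF sm])
      show "norm (prob (U n)) \<le> exp (- (e\<^sup>2 / 16) * real n)" for n
        using std_gaussian_family_tail_upper[OF M fam[of n] fin[of n] card[of n] e] by (simp add: U_def)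
    qed
    show "U n \<in> sets M" for n unfolding U_def by measurable
  qed (auto simp: emeasure_eq_measure)
  moreover have "AE \<omega> in M. \<forall>\<^sub>F n in sequentially. \<omega> \<in> space M - L n"
  proof (rule borel_cantelli_AE1)
    show "summable (\<lambda>n. prob (L n))"
    proof (rule summable_comparison_test'[OF sm])
      show "norm (prob (L n)) \<le> exp (- (e\<^sup>2 / 16) * real n)" for n
        using std_gaussian_family_tail_lower[OF M fam[of n] fin[of n] card[of n] e] by (simp add: L_def)
    qed
    show "L n \<in> sets M" for n unfolding L_def by measurable
  qed (auto simp: emeasure_eq_measure)
  ultimately show ?thesis
  proof eventually_elim
    case (elim \<omega>)
    from elim show ?case
      by eventually_elim (auto simp: U_def L_def)
  qed
qed

lemma observation_arrayD:
  assumes "observation_array s"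
  shows "1 \<le> i \<Longrightarrow> i < j \<Longrightarrow> j \<le> n \<Longrightarrow> s n i < s n j"
    and "1 \<le> i \<Longrightarrow> i \<le> n \<Longrightarrow> 0 \<le> s n i \<and> s n i \<le> 1"
  using assms by (auto simp: observation_array_def strict_mono_on_def image_subset_iff)

text \<open>Innovations of lag \<open>k\<close> overlap when \<open>k > 1\<close> and are then not
  orthogonal in general. Splitting the indices modulo \<open>k\<close> gives \<open>k\<close>
  families with non-overlapping intervals, and their deviations are added.\<close>

lemma innov_strong_law:
  assumes OU: "OU_process M Z \<theta> v" and pos: "0 < \<theta>" "0 < v" and s: "observation_array s" and k: "1 \<le> k"
  shows "AE \<omega> in M. (\<lambda>n. (\<Sum>i\<in>{1..n - k}. (innov \<theta> v (\<lambda>t. Z t \<omega>) (s n i) (s n (i + k)))\<^sup>2) / n) \<longlonglongrightarrow> 1"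
proof -
  have M: "prob_space M" using OU by (simp add: OU_process_def)
  define A where "A r n = {i \<in> {1..n - k}. i mod k = r}" for r n
  define W where "W n i \<omega> = innov \<theta> v (\<lambda>t. Z t \<omega>) (s n i) (s n (i + k))" for n i \<omega>
  have fin: "finite (A r n)" for r n by (simp add: A_def)
  have card: "card (A r n) \<le> n" for r n
  proof -
    have "card (A r n) \<le> card {1..n}" by (intro card_mono) (auto simp: A_def)
    then show ?thesis by simp
  qed
  have fam: "std_gaussian_family M (A r n) (W n)" for r n
    unfolding W_def
  proof (rule innov_std_gaussian_family[OF OU pos fin])
    show "0 \<le> s n i \<and> s n i < s n (i + k) \<and> s n (i + k) \<le> 1" if "i \<in> A r n" for i
      using that observation_arrayD[OF s] k by (auto simp: A_def)
    show "s n (i + k) \<le> s n j" if "i \<in> A r n" "j \<in> A r n" "i < j" for i j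
    proof -
      \<comment> \<open>Distinct indices of one class are at least \<open>k\<close> apart, so their
        intervals meet at most in an endpoint.\<close>
      have "k dvd j - i"
        using that by (auto simp: A_def mod_eq_dvd_iff_nat[symmetric])
      then have "k \<le> j - i" using that(3) by (auto dest: dvd_imp_le)
      then have "i + k \<le> j" using that(3) by simp
      moreover have "j \<le> n" using that by (auto simp: A_def)
      ultimately show ?thesis
        using that observation_arrayD(1)[OF s, of "i + k" j n] by (cases "i + k = j") (auto simp: A_def)
    qed
  qed
  \<comment> \<open>Tolerances \<open>1 / Suc m\<close> keep the number of null sets
    countable.\<close>
  have "AE \<omega> in M. \<forall>r<k. \<forall>m. \<forall>\<^sub>F n in sequentially.
      \<bar>(\<Sum>i\<in>A r n. (W n i \<omega>)\<^sup>2) - card (A r n)\<bar> < (1 / Suc m) * n"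
    by (intro AE_all_countable[THEN iffD2] allI AE_impI
        std_gaussian_family_borel_cantelli[OF M fam fin card]) auto
  then show ?thesis
  proof eventually_elim
    case (elim \<omega>)
    have "\<forall>\<^sub>F n in sequentially. \<bar>(\<Sum>i\<in>{1..n - k}. (W n i \<omega>)\<^sup>2) / n - 1\<bar> < e" if e: "e > 0" for e
    proof -
      \<comment> \<open>Half of \<open>e\<close> is divided among the \<open>k\<close> classes; the
        other half pays for the \<open>k\<close> indices missing from
        \<open>{1..n - k}\<close>.\<close>
      obtain m where m: "1 / Suc m < e / (2 * k)"
        using nat_approx_posE[of "e / (2 * k)"] e k by auto
      have "\<forall>\<^sub>F n in sequentially. \<forall>r\<in>{..<k}. \<bar>(\<Sum>i\<in>A r n. (W n i \<omega>)\<^sup>2) - card (A r n)\<bar> < (1 / Suc m) * n"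
        using elim by (intro eventually_ball_finite) auto
      moreover have "\<forall>\<^sub>F n in sequentially. 2 * k / e < real n"
        using filterlim_real_sequentially by (auto simp: filterlim_at_top_dense)
      ultimately show ?thesis using eventually_gt_at_top[of k]
      proof eventually_elim
        case (elim n)
        have grp: "(\<Sum>r<k. \<Sum>i\<in>A r n. h i) = (\<Sum>i\<in>{1..n - k}. h i)" for h :: "nat \<Rightarrow> real"
          unfolding A_def using k by (intro sum.group) auto
        have "(\<Sum>i\<in>{1..n - k}. (W n i \<omega>)\<^sup>2) - real (n - k) =
          (\<Sum>r<k. (\<Sum>i\<in>A r n. (W n i \<omega>)\<^sup>2) - card (A r n))"
          using grp[of "\<lambda>i. (W n i \<omega>)\<^sup>2"] grp[of "\<lambda>i. 1"] by (simp add: sum_subtractf)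
        also have "\<bar>\<dots>\<bar> \<le> (\<Sum>r<k. (1 / Suc m) * n)"
          using elim(1) by (intro order_trans[OF sum_abs] sum_mono) (auto intro: less_imp_le)
        also have "\<dots> = k * (1 / Suc m) * n" by simp
        also have "\<dots> < k * (e / (2 * k)) * n"
          using m k elim(3) by (intro mult_strict_right_mono mult_strict_left_mono) auto
        also have "\<dots> = e / 2 * n" using k by simp
        finally have "\<bar>(\<Sum>i\<in>{1..n - k}. (W n i \<omega>)\<^sup>2) - (real n - k)\<bar> < e / 2 * n"
          using elim(3) by (simp add: of_nat_diff)
        moreover have "real k < e / 2 * n" using elim(2) e by (simp add: field_simps)
        ultimately have "\<bar>(\<Sum>i\<in>{1..n - k}. (W n i \<omega>)\<^sup>2) - n\<bar> < e * n" by linarith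
        then have "\<bar>((\<Sum>i\<in>{1..n - k}. (W n i \<omega>)\<^sup>2) - n) / n\<bar> < e"
          using elim(3) by (simp add: abs_divide field_simps)
        then show ?case using elim(3) by (simp add: diff_divide_distrib)
      qed
    qed
    then show ?case
      by (auto simp: tendsto_iff dist_real_def W_def)
  qed
qed

section \<open>Pathwise expansion of the likelihood\<close>

text \<open>The conditional variance \<open>v (1 - exp (- 2 \<theta> \<delta>))\<close> is \<open>\<theta> v\<close> times this ratio, which is
  \<open>2 \<delta>\<close> to first order whatever \<open>\<theta>\<close> is.\<close>

definition span_ratio :: "real \<Rightarrow> real \<Rightarrow> real" where
  "span_ratio \<theta> \<delta> = (1 - exp (- 2 * \<theta> * \<delta>)) / \<theta>"

text \<open>Both bounds are \<open>1 + x \<le> exp x\<close>, at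
  \<open>x = 2 \<theta> \<delta>\<close> and at its negative. They do not degenerate as \<theta>
  tends to 0, which is why \<theta> needs no positive lower bound later.\<close>

lemma span_ratio_bounds:
  assumes "0 < \<theta>"
  shows "2 * \<delta> * exp (- 2 * \<theta> * \<delta>) \<le> span_ratio \<theta> \<delta>" and "span_ratio \<theta> \<delta> \<le> 2 * \<delta>"
proof -
  have "1 - exp (- 2 * \<theta> * \<delta>) \<le> 2 * \<theta> * \<delta>"
    using exp_ge_add_one_self[of "- 2 * \<theta> * \<delta>"] by linarith
  then show "span_ratio \<theta> \<delta> \<le> 2 * \<delta>"
    using assms by (simp add: span_ratio_def field_simps)
  have "(1 + 2 * \<theta> * \<delta>) * exp (- 2 * \<theta> * \<delta>) \<le> exp (2 * \<theta> * \<delta>) * exp (- 2 * \<theta> * \<delta>)"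
    by (intro mult_right_mono exp_ge_add_one_self) simp
  then have "2 * \<theta> * \<delta> * exp (- 2 * \<theta> * \<delta>) \<le> 1 - exp (- 2 * \<theta> * \<delta>)"
    by (simp add: mult_exp_exp algebra_simps)
  then show "2 * \<delta> * exp (- 2 * \<theta> * \<delta>) \<le> span_ratio \<theta> \<delta>"
    using assms by (simp add: span_ratio_def field_simps)
qed

lemma span_ratio_pos:
  assumes "0 < \<theta>" "0 < \<delta>"
  shows "0 < span_ratio \<theta> \<delta>"
  using assms by (simp add: span_ratio_def)

text \<open>Both logarithms lie between \<open>ln (2 \<delta>) - 2 \<beta> \<delta>\<close> and
  \<open>ln (2 \<delta>)\<close>. The divergent \<open>ln \<delta>\<close> cancels, and the error is
  linear in \<delta>, hence bounded after summation over the spacings.\<close>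

lemma ln_span_ratio_diff:
  assumes "0 < \<theta>" "\<theta> \<le> \<beta>" "0 < \<theta>'" "\<theta>' \<le> \<beta>" "0 < \<delta>"
  shows "\<bar>ln (span_ratio \<theta> \<delta>) - ln (span_ratio \<theta>' \<delta>)\<bar> \<le> 2 * \<beta> * \<delta>"
proof -
  have *: "ln (2 * \<delta>) - 2 * \<beta> * \<delta> \<le> ln (span_ratio \<eta> \<delta>) \<and> ln (span_ratio \<eta> \<delta>) \<le> ln (2 * \<delta>)"
    if "0 < \<eta>" "\<eta> \<le> \<beta>" for \<eta>
  proof -
    have "ln (2 * \<delta> * exp (- 2 * \<eta> * \<delta>)) \<le> ln (span_ratio \<eta> \<delta>)"
      using span_ratio_bounds(1)[OF that(1), of \<delta>] span_ratio_pos[OF that(1) assms(5)] assms(5)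
      by (subst ln_le_cancel_iff) auto
    moreover have "ln (2 * \<delta> * exp (- 2 * \<eta> * \<delta>)) = ln (2 * \<delta>) - 2 * \<eta> * \<delta>"
      using assms(5) by (simp add: ln_mult)
    moreover have "\<eta> * \<delta> \<le> \<beta> * \<delta>" using that assms(5) by simp
    moreover have "ln (span_ratio \<eta> \<delta>) \<le> ln (2 * \<delta>)"
      using span_ratio_bounds(2)[OF that(1), of \<delta>] span_ratio_pos[OF that(1) assms(5)] assms(5)
      by (subst ln_le_cancel_iff) auto
    ultimately show ?thesis by (simp add: mult.assoc)
  qed
  show ?thesis using *[of \<theta>] *[of \<theta>'] assms by linarith
qed

text \<open>Exponentiates the preceding estimate; \<open>\<delta> \<le> 1\<close> bounds the
  exponent by \<open>2 \<beta>\<close>, which makes the error linear in \<delta>.\<close>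

lemma span_ratio_quotient:
  assumes "0 < \<theta>" "\<theta> \<le> \<beta>" "0 < \<theta>'" "\<theta>' \<le> \<beta>" "0 < \<delta>" "\<delta> \<le> 1"
  shows "\<bar>span_ratio \<theta>' \<delta> / span_ratio \<theta> \<delta> - 1\<bar> \<le> 2 * \<beta> * exp (2 * \<beta>) * \<delta>"
proof -
  define x where "x = 2 * \<beta> * \<delta>"
  have x: "0 < x" "x \<le> 2 * \<beta>" using assms by (auto simp: x_def mult_left_le)
  define q where "q = span_ratio \<theta>' \<delta> / span_ratio \<theta> \<delta>"
  have q: "0 < q" using assms span_ratio_pos by (simp add: q_def)
  have "\<bar>ln q\<bar> \<le> x"
    using ln_span_ratio_diff[OF assms(3,4,1,2,5)] assms span_ratio_pos[of \<theta> \<delta>] span_ratio_pos[of \<theta>' \<delta>]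
    by (simp add: q_def x_def ln_div)
  then have "exp (- x) \<le> q" "q \<le> exp x"
    using q exp_le_cancel_iff[of "- x" "ln q"] exp_le_cancel_iff[of "ln q" x] by (auto simp: abs_le_iff)
  moreover have "1 - x \<le> exp (- x)" using exp_ge_add_one_self[of "- x"] by simp
  moreover have "exp x - 1 \<le> x * exp x"
    using mult_right_mono[OF exp_ge_add_one_self[of "- x"], of "exp x"] by (simp add: mult_exp_exp algebra_simps)
  moreover have "x * exp x \<le> x * exp (2 * \<beta>)" "x * 1 \<le> x * exp (2 * \<beta>)"
    using x by (auto intro!: mult_left_mono)
  ultimately have "\<bar>q - 1\<bar> \<le> x * exp (2 * \<beta>)" by linarith
  then show ?thesis by (simp add: q_def x_def mult_ac)
qed

lemma abs_exp_diff_le: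
  fixes \<theta> \<theta>' \<beta> \<delta> :: real
  assumes "0 < \<theta>" "\<theta> \<le> \<beta>" "0 < \<theta>'" "\<theta>' \<le> \<beta>" "0 < \<delta>"
  shows "\<bar>exp (- \<theta>' * \<delta>) - exp (- \<theta> * \<delta>)\<bar> \<le> \<beta> * \<delta>"
proof -
  have *: "1 - \<beta> * \<delta> \<le> exp (- \<eta> * \<delta>) \<and> exp (- \<eta> * \<delta>) \<le> 1" if "0 < \<eta>" "\<eta> \<le> \<beta>" for \<eta>
  proof -
    have "\<eta> * \<delta> \<le> \<beta> * \<delta>" using that assms by simp
    moreover have "1 - \<eta> * \<delta> \<le> exp (- \<eta> * \<delta>)"
      using exp_ge_add_one_self[of "- \<eta> * \<delta>"] by simp
    moreover have "exp (- \<eta> * \<delta>) \<le> 1" using that assms by simp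
    ultimately show ?thesis by linarith
  qed
  show ?thesis using *[of \<theta>] *[of \<theta>'] assms by linarith
qed

text \<open>Young's inequality with weight \<open>sqrt e\<close>: the share of \<open>y^2\<close>
  becomes as small as desired, at the price of a factor \<open>1 / e\<close> on
  \<open>k^2\<close>.\<close>

lemma square_perturbation:
  fixes y k e :: real
  assumes "0 < e"
  shows "\<bar>(y + k)\<^sup>2 - y\<^sup>2\<bar> \<le> e * y\<^sup>2 + (1 + 1 / e) * k\<^sup>2"
proof -
  have "2 * (sqrt e * \<bar>y\<bar>) * (\<bar>k\<bar> / sqrt e) \<le> (sqrt e * \<bar>y\<bar>)\<^sup>2 + (\<bar>k\<bar> / sqrt e)\<^sup>2"
    by (rule sum_squares_bound)
  then have "2 * \<bar>y * k\<bar> \<le> e * y\<^sup>2 + k\<^sup>2 / e"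
    using assms by (simp add: power_mult_distrib power_divide abs_mult)
  moreover have "(y + k)\<^sup>2 - y\<^sup>2 = 2 * (y * k) + k\<^sup>2" by (simp add: power2_eq_square algebra_simps)
  moreover have "(1 + 1 / e) * k\<^sup>2 = k\<^sup>2 + k\<^sup>2 / e" by (simp add: distrib_right)
  ultimately show ?thesis using zero_le_power2[of k] by linarith
qed

text \<open>Passing from \<theta>0 to \<theta> shifts the residual by O(\<delta>). Squared and
  divided by a variance of order \<delta>, the shift costs O(\<delta>), while changing the variance
  multiplies by \<open>1 + O(\<delta>)\<close> apart from the factor \<open>R\<close>. The constant
  precedes all other quantifiers, and the whole error is proportional to \<open>R\<close>.\<close>

lemma weighted_residual_approx:
  fixes B e :: real
  assumes "0 < \<theta>0" "\<theta>0 \<le> \<beta>" "0 < v0" "0 < e" "e \<le> 1"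
  shows "\<exists>C\<ge>0. \<forall>\<theta> v z s t. 0 < \<theta> \<longrightarrow> \<theta> \<le> \<beta> \<longrightarrow> 0 < v \<longrightarrow> 0 \<le> s \<longrightarrow> s < t \<longrightarrow> t \<le> 1 \<longrightarrow>
     \<bar>z s\<bar> \<le> B \<longrightarrow> \<bar>z t\<bar> \<le> B \<longrightarrow>
     \<bar>(z t - exp (- \<theta> * (t - s)) * z s)\<^sup>2 / (v * (1 - exp (- 2 * \<theta> * (t - s))))
       - \<theta>0 * v0 / (\<theta> * v) * (innov \<theta>0 v0 z s t)\<^sup>2\<bar>
     \<le> \<theta>0 * v0 / (\<theta> * v) * (e * (innov \<theta>0 v0 z s t)\<^sup>2 + C * (t - s))"
proof -
  define p0 where "p0 = \<theta>0 * v0"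
  \<comment> \<open>\<open>\<kappa> \<delta>\<close> is a lower bound for the true conditional
    variance \<open>g0\<close>. Then \<open>C1 \<delta>\<close> bounds the relative change of
    variance, \<open>C2 \<delta>\<close> bounds \<open>k^2\<close>, and \<open>C3\<close> bounds
    \<open>\<delta> X\<close>.\<close>
  define \<kappa> where "\<kappa> = 2 * p0 * exp (- 2 * \<beta>)"
  define C1 where "C1 = 2 * \<beta> * exp (2 * \<beta>)"
  define C2 where "C2 = \<beta>\<^sup>2 * B\<^sup>2 / \<kappa>"
  define C3 where "C3 = 4 * B\<^sup>2 / \<kappa>"
  define C where "C = e / 2 * C2 + 4 * C1\<^sup>2 * C3 / e + (1 + 2 / e) * C2"
  have pos: "0 < p0" "0 < \<kappa>" "0 < \<beta>" "0 < C1" "0 \<le> C2" "0 \<le> C3"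
    using assms by (auto simp: p0_def \<kappa>_def C1_def C2_def C3_def)
  show ?thesis
  proof (intro exI[of _ C] conjI allI impI)
    show "0 \<le> C" using pos assms by (auto simp: C_def)
    fix \<theta> v :: real and z :: "real \<Rightarrow> real" and s t :: real
    assume \<theta>: "0 < \<theta>" "\<theta> \<le> \<beta>" and v: "0 < v" and st: "0 \<le> s" "s < t" "t \<le> 1"
      and z: "\<bar>z s\<bar> \<le> B" "\<bar>z t\<bar> \<le> B"
    define \<delta> where "\<delta> = t - s"
    have \<delta>: "0 < \<delta>" "\<delta> \<le> 1" using st by (auto simp: \<delta>_def)
    define g0 where "g0 = p0 * span_ratio \<theta>0 \<delta>"
    have g0_eq: "g0 = v0 * (1 - exp (- 2 * \<theta>0 * \<delta>))"
      using assms by (simp add: g0_def p0_def span_ratio_def)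
    have "\<kappa> * \<delta> \<le> p0 * (2 * \<delta> * exp (- 2 * \<theta>0 * \<delta>))"
    proof -
      have "\<theta>0 * \<delta> \<le> \<beta> * 1" using assms \<delta> by (intro mult_mono) auto
      then show ?thesis using pos \<delta> by (simp add: \<kappa>_def)
    qed
    also have "\<dots> \<le> g0"
      unfolding g0_def using span_ratio_bounds(1)[OF assms(1)] pos by (intro mult_left_mono) auto
    finally have g0: "\<kappa> * \<delta> \<le> g0" .
    then have g0_pos: "0 < g0" using pos \<delta> by (smt (verit) mult_pos_pos)
    define q where "q = span_ratio \<theta>0 \<delta> / span_ratio \<theta> \<delta>"
    have q: "\<bar>q - 1\<bar> \<le> C1 * \<delta>"
      using span_ratio_quotient[OF \<theta> assms(1,2) \<delta>] by (simp add: q_def C1_def)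
    define h where "h = exp (- \<theta>0 * \<delta>) - exp (- \<theta> * \<delta>)"
    have h: "\<bar>h\<bar> \<le> \<beta> * \<delta>"
      using abs_exp_diff_le[OF \<theta> assms(1,2) \<delta>(1)] by (simp add: h_def)
    define y where "y = (z t - exp (- \<theta>0 * \<delta>) * z s) / sqrt g0"
    define k where "k = h * z s / sqrt g0"
    define X where "X = (z t - exp (- \<theta> * \<delta>) * z s)\<^sup>2 / g0"
    have X: "X = (y + k)\<^sup>2"
      using g0_pos by (simp add: X_def y_def k_def h_def add_divide_distrib[symmetric] power_divide algebra_simps)
    have W: "innov \<theta>0 v0 z s t = y"
      by (simp add: innov_def y_def g0_eq \<delta>_def)
    have k2: "k\<^sup>2 \<le> C2 * \<delta>"
    proof -
      have "\<bar>h * z s\<bar> \<le> (\<beta> * \<delta>) * B"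
        unfolding abs_mult using h z pos \<delta> by (intro mult_mono) auto
      then have "(h * z s)\<^sup>2 \<le> ((\<beta> * \<delta>) * B)\<^sup>2"
        by (rule abs_le_square_iff[THEN iffD1, OF order_trans[OF _ abs_ge_self]])
      then have "(h * z s)\<^sup>2 / g0 \<le> ((\<beta> * \<delta>) * B)\<^sup>2 / (\<kappa> * \<delta>)"
        using g0 pos \<delta> by (intro frac_le) auto
      also have "\<dots> = C2 * \<delta>"
        using \<delta> pos by (simp add: C2_def power2_eq_square field_simps)
      finally show ?thesis using g0_pos by (simp add: k_def power_divide)
    qed
    have X0: "0 \<le> X" by (simp add: X)
    have \<delta>X: "\<delta> * X \<le> C3"
    proof -
      have "\<bar>exp (- \<theta> * \<delta>) * z s\<bar> \<le> 1 * B"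
        unfolding abs_mult using \<theta> \<delta> z by (intro mult_mono) auto
      then have "\<bar>z t - exp (- \<theta> * \<delta>) * z s\<bar> \<le> 2 * B" using z by linarith
      then have "(z t - exp (- \<theta> * \<delta>) * z s)\<^sup>2 \<le> (2 * B)\<^sup>2"
        by (rule abs_le_square_iff[THEN iffD1, OF order_trans[OF _ abs_ge_self]])
      then have "X \<le> (2 * B)\<^sup>2 / (\<kappa> * \<delta>)"
        unfolding X_def using g0 pos \<delta> by (intro frac_le) auto
      then have "\<delta> * X \<le> \<delta> * ((2 * B)\<^sup>2 / (\<kappa> * \<delta>))" using \<delta> by (intro mult_left_mono) auto
      also have "\<dots> = C3" using \<delta> pos by (simp add: C3_def power_mult_distrib)
      finally show ?thesis .
    qed
    \<comment> \<open>The bound \<open>\<delta> X \<le> C3\<close> alone gives a constant for each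
      pair, which is not summable. For small \<delta> the term is therefore absorbed into a small
      multiple of \<open>X\<close>; for large \<delta> a constant is itself at most a multiple of
      \<delta>.\<close>
    have "C1 * \<delta> * X \<le> e / 4 * X + 4 * C1\<^sup>2 * C3 / e * \<delta>"
    proof (cases "C1 * \<delta> \<le> e / 4")
      case True
      then have "C1 * \<delta> * X \<le> e / 4 * X" using X0 by (intro mult_right_mono)
      moreover have "0 \<le> 4 * C1\<^sup>2 * C3 / e * \<delta>" using pos assms \<delta> by simp
      ultimately show ?thesis by linarith
    next
      case False
      then have "1 \<le> 4 * C1 / e * \<delta>" using assms by (simp add: field_simps)
      then have "C1 * C3 * 1 \<le> C1 * C3 * (4 * C1 / e * \<delta>)" using pos by (intro mult_left_mono) auto
      moreover have "C1 * (\<delta> * X) \<le> C1 * C3" using pos \<delta>X by simp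
      moreover have "0 \<le> e / 4 * X" using X0 assms by simp
      ultimately show ?thesis by (simp add: power2_eq_square mult_ac)
    qed
    moreover have "X \<le> 2 * y\<^sup>2 + 2 * k\<^sup>2"
      using zero_le_power2[of "y - k"] unfolding X by (simp add: power2_eq_square algebra_simps)
    then have "e / 4 * X \<le> e / 4 * (2 * y\<^sup>2 + 2 * k\<^sup>2)" using assms by (intro mult_left_mono) auto
    moreover have "\<bar>X - y\<^sup>2\<bar> \<le> e / 2 * y\<^sup>2 + (1 + 2 / e) * k\<^sup>2"
      using square_perturbation[of "e / 2" y k] assms unfolding X by simp
    moreover have "\<bar>(q - 1) * X\<bar> \<le> C1 * \<delta> * X"
      unfolding abs_mult using q X0 by (intro mult_mono) auto
    moreover have "(e / 2 + (1 + 2 / e)) * k\<^sup>2 \<le> (e / 2 + (1 + 2 / e)) * (C2 * \<delta>)"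
      using k2 assms by (intro mult_left_mono) auto
    ultimately have "\<bar>q * X - y\<^sup>2\<bar> \<le> e * y\<^sup>2 + C * \<delta>"
      by (simp add: C_def algebra_simps)
    then have "p0 / (\<theta> * v) * \<bar>q * X - y\<^sup>2\<bar> \<le> p0 / (\<theta> * v) * (e * y\<^sup>2 + C * \<delta>)"
      using pos \<theta> v by (intro mult_left_mono) auto
    moreover have "p0 / (\<theta> * v) * \<bar>q * X - y\<^sup>2\<bar> = \<bar>p0 / (\<theta> * v) * (q * X) - p0 / (\<theta> * v) * y\<^sup>2\<bar>"
      using pos \<theta> v by (simp add: abs_mult right_diff_distrib[symmetric] del: times_divide_eq_left)
    moreover have "p0 / (\<theta> * v) * (q * X) = (z t - exp (- \<theta> * \<delta>) * z s)\<^sup>2 / (v * (1 - exp (- 2 * \<theta> * \<delta>)))"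
    proof -
      have "span_ratio \<theta>0 \<delta> \<noteq> 0" "p0 \<noteq> 0"
        using span_ratio_pos[OF assms(1) \<delta>(1)] pos by auto
      then have "p0 * (q * X) = (z t - exp (- \<theta> * \<delta>) * z s)\<^sup>2 / span_ratio \<theta> \<delta>"
        by (simp add: q_def X_def g0_def)
      moreover have "1 - exp (- 2 * \<theta> * \<delta>) = \<theta> * span_ratio \<theta> \<delta>"
        using \<theta> by (simp add: span_ratio_def)
      ultimately show ?thesis by (simp only:) (simp add: mult_ac)
    qed
    ultimately show "\<bar>(z t - exp (- \<theta> * (t - s)) * z s)\<^sup>2 / (v * (1 - exp (- 2 * \<theta> * (t - s))))
       - \<theta>0 * v0 / (\<theta> * v) * (innov \<theta>0 v0 z s t)\<^sup>2\<bar>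
     \<le> \<theta>0 * v0 / (\<theta> * v) * (e * (innov \<theta>0 v0 z s t)\<^sup>2 + C * (t - s))"
      unfolding W by (simp only: \<delta>_def[symmetric] p0_def[symmetric])
  qed
qed

section \<open>Sums over pairs of a fixed lag\<close>

text \<open>Raising the lag by one adds a telescoping sum, of which two boundary values remain.
  Hence the bound does not depend on \<open>m\<close>.\<close>

lemma abs_lag_sum_le:
  fixes f :: "nat \<Rightarrow> real"
  assumes "\<And>i. 1 \<le> i \<Longrightarrow> i \<le> m + k \<Longrightarrow> \<bar>f i\<bar> \<le> C" and "0 \<le> C"
  shows "\<bar>\<Sum>i\<in>{1..m}. f i - f (i + k)\<bar> \<le> 2 * real k * C"
  using assms
proof (induction k)
  case 0
  then show ?case by simp
next
  case (Suc k)
  have "(\<Sum>i\<in>{1..m}. f (i + k) - f (i + Suc k)) = f (1 + k) - f (m + 1 + k)"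
    by (induction m) auto
  moreover have "\<bar>f (1 + k)\<bar> \<le> C" "\<bar>f (m + 1 + k)\<bar> \<le> C"
    using Suc.prems by (auto simp: add_ac)
  moreover have "\<bar>\<Sum>i\<in>{1..m}. f i - f (i + k)\<bar> \<le> 2 * real k * C"
    using Suc by auto
  moreover have "(\<Sum>i\<in>{1..m}. f i - f (i + Suc k)) =
      (\<Sum>i\<in>{1..m}. f i - f (i + k)) + (\<Sum>i\<in>{1..m}. f (i + k) - f (i + Suc k))"
    by (simp add: sum.distrib[symmetric])
  ultimately show ?case by (simp add: algebra_simps)
qed

lemma pair_cond_loglik_lag_sum:
  assumes "\<And>k. K < k \<Longrightarrow> w k = 0"
  shows "pair_cond_loglik w n s z \<psi> =
    (\<Sum>k\<in>{1..K}. w k * (\<Sum>i\<in>{1..n - k}.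
       cond_loglik z (s i) (s (i + k)) \<psi> + cond_loglik z (s (i + k)) (s i) \<psi>))"
proof -
  define F where "F i j = cond_loglik z (s i) (s j) \<psi>" for i j
  define U where "U = {(i, j). i \<in> {1..n} \<and> j \<in> {1..n} \<and> i < j}"
  have finU: "finite U"
    by (rule finite_subset[of _ "{1..n} \<times> {1..n}"]) (auto simp: U_def)
  have "pair_cond_loglik w n s z \<psi> =
      (\<Sum>(i, j)\<in>Sigma {1..n} (\<lambda>i. {1..n} - {i}). w (nat \<bar>int i - int j\<bar>) * F i j)"
    unfolding pair_cond_loglik_def F_def by (simp add: sum.Sigma)
  also have "Sigma {1..n} (\<lambda>i. {1..n} - {i}) = U \<union> prod.swap ` U"
    by (auto simp: U_def image_iff)
  also have "(\<Sum>(i, j)\<in>U \<union> prod.swap ` U. w (nat \<bar>int i - int j\<bar>) * F i j) =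
      (\<Sum>(i, j)\<in>U. w (nat \<bar>int i - int j\<bar>) * F i j) + (\<Sum>(i, j)\<in>prod.swap ` U. w (nat \<bar>int i - int j\<bar>) * F i j)"
    using finU by (intro sum.union_disjoint) (auto simp: U_def)
  also have "(\<Sum>(i, j)\<in>prod.swap ` U. w (nat \<bar>int i - int j\<bar>) * F i j) =
      (\<Sum>(i, j)\<in>U. w (nat \<bar>int j - int i\<bar>) * F j i)"
    by (subst sum.reindex) (auto simp: case_prod_beta)
  also have "(\<Sum>(i, j)\<in>U. w (nat \<bar>int i - int j\<bar>) * F i j) + \<dots> =
      (\<Sum>(i, j)\<in>U. w (j - i) * (F i j + F j i))"
    unfolding sum.distrib[symmetric] case_prod_beta
    by (intro sum.cong refl) (auto simp: U_def nat_diff_distrib distrib_left abs_if)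
  \<comment> \<open>The exceptional set holds the pairs whose lag exceeds \<open>K\<close>, where
    the weight vanishes. A lag \<open>k \<ge> n\<close> contributes nothing, since
    \<open>n - k\<close> truncates to 0 and the range of \<open>i\<close> is empty.\<close>
  also have "\<dots> = (\<Sum>(k, i)\<in>Sigma {1..K} (\<lambda>k. {1..n - k}). w k * (F i (i + k) + F (i + k) i))"
    using assms finU
    by (intro sum.reindex_bij_witness_not_neutral[where S' = "{p \<in> U. K < snd p - fst p}" and T' = "{}"
          and i = "\<lambda>(k, i). (i, i + k)" and j = "\<lambda>(i, j). (j - i, i)"])
      (auto simp: U_def)
  also have "\<dots> = (\<Sum>k\<in>{1..K}. w k * (\<Sum>i\<in>{1..n - k}. F i (i + k) + F (i + k) i))"
    by (subst sum.Sigma[symmetric]) (auto simp: sum_distrib_left)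
  finally show ?thesis unfolding F_def .
qed

text \<open>The forward and backward squared residuals differ by \<open>((z s)\<^sup>2 - (z t)\<^sup>2) / v\<close>, which telescopes
  in a sum over pairs of a fixed lag.\<close>

lemma cond_loglik_pair:
  assumes "0 < \<theta>" "0 < v" "s < t"
  shows "cond_loglik z s t (\<theta>, v) + cond_loglik z t s (\<theta>, v) =
    2 * ln (\<theta> * v * span_ratio \<theta> (t - s))
    + 2 * ((z t - exp (- \<theta> * (t - s)) * z s)\<^sup>2 / (v * (1 - exp (- 2 * \<theta> * (t - s)))))
    + ((z s)\<^sup>2 - (z t)\<^sup>2) / v"
proof -
  define r where "r = exp (- \<theta> * (t - s))"
  have r2: "exp (- 2 * \<theta> * (t - s)) = r\<^sup>2"
    by (simp add: r_def power2_eq_square mult_exp_exp algebra_simps)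
  have "r < 1" "0 < r" using assms by (auto simp: r_def)
  then have r1: "0 < 1 - r\<^sup>2" by (simp add: power_less_one_iff)
  have e: "ln v + ln (1 - r\<^sup>2) = ln (\<theta> * v * span_ratio \<theta> (t - s))"
  proof -
    have sr: "\<theta> * v * span_ratio \<theta> (t - s) = v * (1 - r\<^sup>2)"
      unfolding span_ratio_def r2 using assms by simp
    show ?thesis unfolding sr using assms r1 by (simp add: ln_mult_pos)
  qed
  have "(z s - r * z t)\<^sup>2 = (z t - r * z s)\<^sup>2 + (1 - r\<^sup>2) * ((z s)\<^sup>2 - (z t)\<^sup>2)"
    by (simp add: power2_eq_square algebra_simps)
  then have "(z s - r * z t)\<^sup>2 / (v * (1 - r\<^sup>2)) = (z t - r * z s)\<^sup>2 / (v * (1 - r\<^sup>2)) + ((z s)\<^sup>2 - (z t)\<^sup>2) / v"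
    using r1 assms by (simp add: add_divide_distrib)
  then show ?thesis
    using assms e by (simp add: cond_loglik_def abs_if r2[simplified] flip: r_def[simplified])
qed

section \<open>Expansion at a fixed lag\<close>

text \<open>Only the logarithms at the true parameter are subtracted. They are free of
  \<open>\<psi>\<close>, so minimisers do not change, and they remove the \<open>ln \<delta>\<close>
  terms, over which nothing is assumed. The residuals stay, so the value at \<open>R = 1\<close> is
  about \<open>2 n\<close> and not 0.\<close>

definition lag_excess ::
    "real \<Rightarrow> real \<Rightarrow> (real \<Rightarrow> real) \<Rightarrow> (nat \<Rightarrow> real) \<Rightarrow> nat \<Rightarrow> nat \<Rightarrow> real \<times> real \<Rightarrow> real" where
  "lag_excess \<theta>0 v0 z s n k \<psi> =
     (\<Sum>i\<in>{1..n - k}. cond_loglik z (s i) (s (i + k)) \<psi> + cond_loglik z (s (i + k)) (s i) \<psi>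
        - 2 * ln (\<theta>0 * v0 * span_ratio \<theta>0 (s (i + k) - s i)))"

definition sq_innov_sum ::
    "real \<Rightarrow> real \<Rightarrow> (real \<Rightarrow> real) \<Rightarrow> (nat \<Rightarrow> real) \<Rightarrow> nat \<Rightarrow> nat \<Rightarrow> real" where
  "sq_innov_sum \<theta>0 v0 z s n k = (\<Sum>i\<in>{1..n - k}. (innov \<theta>0 v0 z (s i) (s (i + k)))\<^sup>2)"

text \<open>Everything the expansion uses about path and points; its constants see the path only
  through \<open>B\<close>.\<close>

definition bounded_sample :: "(real \<Rightarrow> real) \<Rightarrow> (nat \<Rightarrow> real) \<Rightarrow> nat \<Rightarrow> real \<Rightarrow> bool" where
  "bounded_sample z s n B \<longleftrightarrow>
     (\<forall>i\<in>{1..n}. 0 \<le> s i \<and> s i \<le> 1 \<and> \<bar>z (s i)\<bar> \<le> B) \<and>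
     (\<forall>i j. 1 \<le> i \<longrightarrow> i < j \<longrightarrow> j \<le> n \<longrightarrow> s i < s j)"

text \<open>The bound is free of \<open>n\<close>, so errors of order \<delta> per pair are
  negligible against \<open>n\<close>.\<close>

lemma bounded_sample_sum_spacings:
  assumes "bounded_sample z s n B" "k \<le> n"
  shows "(\<Sum>i\<in>{1..n - k}. s (i + k) - s i) \<le> 2 * real k"
proof -
  have "\<bar>\<Sum>i\<in>{1..n - k}. s i - s (i + k)\<bar> \<le> 2 * real k * 1"
    using assms by (intro abs_lag_sum_le) (auto simp: bounded_sample_def)
  moreover have "(\<Sum>i\<in>{1..n - k}. s (i + k) - s i) = - (\<Sum>i\<in>{1..n - k}. s i - s (i + k))"
    by (simp add: sum_negf[symmetric])
  ultimately show ?thesis by linarith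
qed

lemma abs_sum_diff_le:
  fixes f g h :: "'i \<Rightarrow> real"
  assumes "\<And>i. i \<in> A \<Longrightarrow> \<bar>f i - g i\<bar> \<le> h i"
  shows "\<bar>sum f A - sum g A\<bar> \<le> sum h A"
  unfolding sum_subtractf[symmetric] using assms by (intro order_trans[OF sum_abs] sum_mono)

lemma abs_triangle_three:
  fixes x y z :: real
  assumes "\<bar>x\<bar> \<le> a" "\<bar>y\<bar> \<le> b" "\<bar>z\<bar> \<le> c"
  shows "\<bar>x + y + z\<bar> \<le> a + b + c"
  using assms by linarith

text \<open>Each pair splits into a logarithmic part \<open>L\<close>, close to
  \<open>- ln R\<close>, a residual part \<open>Q\<close>, close to \<open>R\<close> times a squared
  innovation, and a part \<open>T\<close> that telescopes.\<close>

lemma lag_excess_expansion: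
  assumes "0 < \<theta>0" "\<theta>0 \<le> \<beta>" "0 < v0" "0 < e" "e \<le> 1" "1 \<le> k"
  shows "\<exists>C\<ge>0. \<forall>z s n \<theta> v. bounded_sample z s n B \<longrightarrow> k \<le> n \<longrightarrow> 0 < \<theta> \<longrightarrow> \<theta> \<le> \<beta> \<longrightarrow> 0 < v \<longrightarrow>
     \<bar>lag_excess \<theta>0 v0 z s n k (\<theta>, v)
        - (2 * (\<theta>0 * v0 / (\<theta> * v)) * sq_innov_sum \<theta>0 v0 z s n k
           - 2 * (real n - k) * ln (\<theta>0 * v0 / (\<theta> * v)))\<bar>
     \<le> C + \<theta>0 * v0 / (\<theta> * v) * (2 * e * sq_innov_sum \<theta>0 v0 z s n k + C)"
proof -
  obtain Cq where Cq: "0 \<le> Cq" and quad: "\<And>\<theta> v z s t. 0 < \<theta> \<Longrightarrow> \<theta> \<le> \<beta> \<Longrightarrow> 0 < v \<Longrightarrow> 0 \<le> s \<Longrightarrow> s < t \<Longrightarrow> t \<le> 1 \<Longrightarrow>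
     \<bar>z s\<bar> \<le> B \<Longrightarrow> \<bar>z t\<bar> \<le> B \<Longrightarrow>
     \<bar>(z t - exp (- \<theta> * (t - s)) * z s)\<^sup>2 / (v * (1 - exp (- 2 * \<theta> * (t - s))))
       - \<theta>0 * v0 / (\<theta> * v) * (innov \<theta>0 v0 z s t)\<^sup>2\<bar>
     \<le> \<theta>0 * v0 / (\<theta> * v) * (e * (innov \<theta>0 v0 z s t)\<^sup>2 + Cq * (t - s))"
    using weighted_residual_approx[OF assms(1-5), of B] by blast
  define p0 where "p0 = \<theta>0 * v0"
  have p0: "0 < p0" using assms by (simp add: p0_def)
  \<comment> \<open>The summands come, in this order, from \<open>L\<close>, \<open>Q\<close> and
    \<open>T\<close>, each with a spacing or telescoping sum bounded by a multiple of
    \<open>2 k\<close>.\<close>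
  define C where "C = 8 * \<beta> * k + (4 * real k * Cq + 2 * real k * B\<^sup>2 * (\<beta> / p0))"
  have \<beta>: "0 < \<beta>" using assms by simp
  have C1: "8 * \<beta> * k \<le> C" and C2: "4 * real k * Cq + 2 * real k * B\<^sup>2 * (\<beta> / p0) \<le> C" and C0: "0 \<le> C"
    using Cq p0 \<beta> by (auto simp: C_def)
  show ?thesis
  proof (intro exI[of _ C] conjI allI impI)
    show "0 \<le> C" by (rule C0)
    fix z :: "real \<Rightarrow> real" and s :: "nat \<Rightarrow> real" and n :: nat and \<theta> v :: real
    assume bs: "bounded_sample z s n B" and kn: "k \<le> n" and \<theta>: "0 < \<theta>" "\<theta> \<le> \<beta>" and v: "0 < v"
    define I where "I = {1..n - k}"
    define R where "R = p0 / (\<theta> * v)"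
    have R: "0 < R" using p0 \<theta> v by (simp add: R_def)
    define \<delta> where "\<delta> i = s (i + k) - s i" for i
    define W where "W i = innov \<theta>0 v0 z (s i) (s (i + k))" for i
    define Q where "Q i = (z (s (i + k)) - exp (- \<theta> * \<delta> i) * z (s i))\<^sup>2 / (v * (1 - exp (- 2 * \<theta> * \<delta> i)))" for i
    define L where "L i = ln (\<theta> * v * span_ratio \<theta> (\<delta> i)) - ln (p0 * span_ratio \<theta>0 (\<delta> i))" for i
    define T where "T i = ((z (s i))\<^sup>2 - (z (s (i + k)))\<^sup>2) / v" for i
    have ord: "0 \<le> s i" "s i < s (i + k)" "s (i + k) \<le> 1" "\<bar>z (s i)\<bar> \<le> B" "\<bar>z (s (i + k))\<bar> \<le> B" "0 < \<delta> i"
      if "i \<in> I" for i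
      using bs that assms(6) kn by (auto simp: bounded_sample_def I_def \<delta>_def)
    have sum\<delta>: "(\<Sum>i\<in>I. \<delta> i) \<le> 2 * real k"
      using bounded_sample_sum_spacings[OF bs kn] by (simp add: I_def \<delta>_def)
    have S: "sq_innov_sum \<theta>0 v0 z s n k = (\<Sum>i\<in>I. (W i)\<^sup>2)"
      by (simp add: sq_innov_sum_def I_def W_def)
    have "lag_excess \<theta>0 v0 z s n k (\<theta>, v) = (\<Sum>i\<in>I. 2 * L i + 2 * Q i + T i)"
      unfolding lag_excess_def I_def[symmetric]
    proof (intro sum.cong refl)
      fix i assume "i \<in> I"
      show "cond_loglik z (s i) (s (i + k)) (\<theta>, v) + cond_loglik z (s (i + k)) (s i) (\<theta>, v)
          - 2 * ln (\<theta>0 * v0 * span_ratio \<theta>0 (s (i + k) - s i)) = 2 * L i + 2 * Q i + T i"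
        unfolding cond_loglik_pair[OF \<theta>(1) v ord(2)[OF \<open>i \<in> I\<close>]]
        by (simp add: L_def Q_def T_def \<delta>_def p0_def)
    qed
    then have exc: "lag_excess \<theta>0 v0 z s n k (\<theta>, v) = 2 * (\<Sum>i\<in>I. L i) + 2 * (\<Sum>i\<in>I. Q i) + (\<Sum>i\<in>I. T i)"
      by (simp add: sum.distrib sum_distrib_left)
    have "\<bar>(\<Sum>i\<in>I. L i) - (\<Sum>i\<in>I. - ln R)\<bar> \<le> (\<Sum>i\<in>I. 2 * \<beta> * \<delta> i)"
    proof (rule abs_sum_diff_le)
      fix i assume i: "i \<in> I"
      have "0 < span_ratio \<theta> (\<delta> i)" "0 < span_ratio \<theta>0 (\<delta> i)"
        using span_ratio_pos \<theta> assms(1) ord(6)[OF i] by auto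
      then have "L i = - ln R + (ln (span_ratio \<theta> (\<delta> i)) - ln (span_ratio \<theta>0 (\<delta> i)))"
        using p0 \<theta> v by (simp add: L_def R_def ln_mult_pos ln_divide_pos)
      then show "\<bar>L i - - ln R\<bar> \<le> 2 * \<beta> * \<delta> i"
        using ln_span_ratio_diff[OF \<theta> assms(1,2) ord(6)[OF i]] by simp
    qed
    also have "\<dots> \<le> 4 * \<beta> * k"
      using mult_left_mono[OF sum\<delta>, of "2 * \<beta>"] \<beta> by (simp add: sum_distrib_left[symmetric])
    finally have L: "\<bar>(\<Sum>i\<in>I. L i) + (real n - k) * ln R\<bar> \<le> 4 * \<beta> * k"
      using kn by (simp add: I_def of_nat_diff)
    have "\<bar>(\<Sum>i\<in>I. Q i) - (\<Sum>i\<in>I. R * (W i)\<^sup>2)\<bar> \<le> (\<Sum>i\<in>I. R * (e * (W i)\<^sup>2 + Cq * \<delta> i))"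
    proof (rule abs_sum_diff_le)
      fix i assume i: "i \<in> I"
      show "\<bar>Q i - R * (W i)\<^sup>2\<bar> \<le> R * (e * (W i)\<^sup>2 + Cq * \<delta> i)"
        using quad[OF \<theta> v ord(1-5)[OF i]] by (simp add: Q_def R_def W_def \<delta>_def p0_def)
    qed
    also have "\<dots> = R * (e * (\<Sum>i\<in>I. (W i)\<^sup>2) + Cq * (\<Sum>i\<in>I. \<delta> i))"
      by (simp only: sum.distrib sum_distrib_left[symmetric])
    also have "\<dots> \<le> R * (e * (\<Sum>i\<in>I. (W i)\<^sup>2) + Cq * (2 * real k))"
      using R Cq sum\<delta> by (intro mult_left_mono add_left_mono) auto
    finally have Q: "\<bar>(\<Sum>i\<in>I. Q i) - R * (\<Sum>i\<in>I. (W i)\<^sup>2)\<bar> \<le> R * (e * (\<Sum>i\<in>I. (W i)\<^sup>2) + Cq * (2 * real k))"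
      by (simp add: sum_distrib_left)
    have T: "\<bar>\<Sum>i\<in>I. T i\<bar> \<le> R * (2 * real k * B\<^sup>2 * (\<beta> / p0))"
    proof -
      have "\<bar>(z (s i))\<^sup>2\<bar> \<le> B\<^sup>2" if "1 \<le> i" "i \<le> n - k + k" for i
      proof -
        have "\<bar>z (s i)\<bar> \<le> \<bar>B\<bar>" using bs that kn by (auto simp: bounded_sample_def intro: order_trans[OF _ abs_ge_self])
        then show ?thesis by (simp add: abs_le_square_iff[symmetric])
      qed
      then have "\<bar>\<Sum>i\<in>I. (z (s i))\<^sup>2 - (z (s (i + k)))\<^sup>2\<bar> \<le> 2 * real k * B\<^sup>2"
        unfolding I_def by (intro abs_lag_sum_le) auto
      then have "\<bar>\<Sum>i\<in>I. T i\<bar> \<le> 2 * real k * B\<^sup>2 * (1 / v)"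
        using v by (simp add: T_def sum_divide_distrib[symmetric] divide_right_mono)
      \<comment> \<open>\<open>1 / v\<close> is unbounded on \<open>J\<close> in general; rewriting
        it in terms of \<open>R\<close> with \<open>\<theta> \<le> \<beta>\<close> makes this error
        proportional to \<open>R\<close> as well.\<close>
      also have "1 / v = R * (\<theta> / p0)" using p0 \<theta> by (simp add: R_def)
      also have "2 * real k * B\<^sup>2 * (R * (\<theta> / p0)) \<le> 2 * real k * B\<^sup>2 * (R * (\<beta> / p0))"
        using R p0 \<theta> by (intro mult_left_mono divide_right_mono) auto
      finally show ?thesis by (simp add: mult_ac)
    qed
    define S where "S = (\<Sum>i\<in>I. (W i)\<^sup>2)"
    have "2 * (\<Sum>i\<in>I. L i) + 2 * (\<Sum>i\<in>I. Q i) + (\<Sum>i\<in>I. T i)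
        - (2 * R * S - 2 * (real n - k) * ln R) =
      2 * ((\<Sum>i\<in>I. L i) + (real n - k) * ln R) + 2 * ((\<Sum>i\<in>I. Q i) - R * S) + (\<Sum>i\<in>I. T i)"
      by (simp add: algebra_simps)
    also have "\<bar>\<dots>\<bar> \<le> 2 * (4 * \<beta> * k) + 2 * (R * (e * S + Cq * (2 * real k))) + R * (2 * real k * B\<^sup>2 * (\<beta> / p0))"
      using L Q T unfolding S_def[symmetric]
      by (intro abs_triangle_three) (simp_all only: abs_mult abs_numeral mult_le_cancel_left_pos zero_less_numeral)
    also have "\<dots> = 8 * \<beta> * k + (R * (2 * e * S) + R * (4 * real k * Cq + 2 * real k * B\<^sup>2 * (\<beta> / p0)))"
      by (simp add: algebra_simps)
    also have "\<dots> \<le> C + (R * (2 * e * S) + R * C)"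
      using R C1 C2 by (intro add_mono mult_left_mono order_refl) auto
    finally have "\<bar>2 * (\<Sum>i\<in>I. L i) + 2 * (\<Sum>i\<in>I. Q i) + (\<Sum>i\<in>I. T i)
        - (2 * R * (\<Sum>i\<in>I. (W i)\<^sup>2) - 2 * (real n - k) * ln R)\<bar>
      \<le> C + R * (2 * e * (\<Sum>i\<in>I. (W i)\<^sup>2) + C)"
      by (simp add: S_def distrib_left)
    then show "\<bar>lag_excess \<theta>0 v0 z s n k (\<theta>, v)
        - (2 * (\<theta>0 * v0 / (\<theta> * v)) * sq_innov_sum \<theta>0 v0 z s n k
           - 2 * (real n - k) * ln (\<theta>0 * v0 / (\<theta> * v)))\<bar>
     \<le> C + \<theta>0 * v0 / (\<theta> * v) * (2 * e * sq_innov_sum \<theta>0 v0 z s n k + C)"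
      unfolding exc S by (simp only: R_def p0_def)
  qed
qed

text \<open>The parameters are quantified inside \<open>eventually\<close>, so a minimiser that
  moves with \<open>n\<close> may be inserted. The error has to grow with \<open>R\<close> and
  \<open>|ln R|\<close>, because \<open>R\<close> is not yet known to stay in a compact set.\<close>

lemma lag_excess_asymptotics:
  fixes \<epsilon> :: real
  assumes "0 < \<theta>0" "\<theta>0 \<le> \<beta>" "0 < v0" "0 < \<epsilon>" "1 \<le> k"
    and bs: "\<And>n. bounded_sample z (s n) n B"
    and law: "(\<lambda>n. sq_innov_sum \<theta>0 v0 z (s n) n k / n) \<longlonglongrightarrow> 1"
  shows "\<forall>\<^sub>F n in sequentially. \<forall>\<theta> v. 0 < \<theta> \<longrightarrow> \<theta> \<le> \<beta> \<longrightarrow> 0 < v \<longrightarrow>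
     \<bar>lag_excess \<theta>0 v0 z (s n) n k (\<theta>, v)
        - 2 * n * (\<theta>0 * v0 / (\<theta> * v) - ln (\<theta>0 * v0 / (\<theta> * v)))\<bar>
     \<le> \<epsilon> * n * (1 + \<theta>0 * v0 / (\<theta> * v) + \<bar>ln (\<theta>0 * v0 / (\<theta> * v))\<bar>)"
proof -
  \<comment> \<open>Once \<open>S \<le> 2 n\<close>, the term \<open>2 e S\<close> costs at most
    \<open>\<epsilon> n / 4\<close>; \<open>C\<close> and \<open>2 |S - n|\<close> cost at most the
    same each, so the coefficient of \<open>R\<close> stays below
    \<open>\<epsilon> n\<close>.\<close>
  define e where "e = min 1 (\<epsilon> / 16)"
  have e: "0 < e" "e \<le> 1" "e \<le> \<epsilon> / 16" using assms(4) by (auto simp: e_def)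
  obtain C where C: "0 \<le> C" and main: "\<And>z s n \<theta> v. bounded_sample z s n B \<Longrightarrow> k \<le> n \<Longrightarrow> 0 < \<theta> \<Longrightarrow> \<theta> \<le> \<beta> \<Longrightarrow> 0 < v \<Longrightarrow>
     \<bar>lag_excess \<theta>0 v0 z s n k (\<theta>, v)
        - (2 * (\<theta>0 * v0 / (\<theta> * v)) * sq_innov_sum \<theta>0 v0 z s n k
           - 2 * (real n - k) * ln (\<theta>0 * v0 / (\<theta> * v)))\<bar>
     \<le> C + \<theta>0 * v0 / (\<theta> * v) * (2 * e * sq_innov_sum \<theta>0 v0 z s n k + C)"
    using lag_excess_expansion[OF assms(1-3) e(1,2) assms(5), of B] by blast
  have "0 < min 1 (\<epsilon> / 8)" using assms(4) by simp
  with law have "\<forall>\<^sub>F n in sequentially. dist (sq_innov_sum \<theta>0 v0 z (s n) n k / n) 1 < min 1 (\<epsilon> / 8)"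
    by (rule tendstoD)
  moreover have "\<forall>\<^sub>F n in sequentially. 4 * (k + C) / \<epsilon> < real n"
    using filterlim_real_sequentially by (auto simp: filterlim_at_top_dense)
  ultimately show ?thesis using eventually_ge_at_top[of k] eventually_gt_at_top[of 0]
  proof eventually_elim
    case (elim n)
    define S where "S = sq_innov_sum \<theta>0 v0 z (s n) n k"
    have n: "0 < real n" using elim by simp
    have "S / n - 1 = (S - n) / n"
      using n by (simp add: diff_divide_distrib)
    then have "\<bar>S / n - 1\<bar> = \<bar>S - n\<bar> / n"
      by (simp add: abs_divide)
    then have S1: "\<bar>S - n\<bar> \<le> \<epsilon> / 8 * n" and S2: "S \<le> 2 * n"
      using elim(1) n by (auto simp: S_def[symmetric] dist_real_def field_simps)
    have kC: "4 * (k + C) \<le> \<epsilon> * n" using elim(2) assms(4) by (simp add: field_simps)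
    have S0: "0 \<le> S" by (simp add: S_def sq_innov_sum_def sum_nonneg)
    show ?case
    proof (intro allI impI)
      fix \<theta> v :: real assume \<theta>: "0 < \<theta>" "\<theta> \<le> \<beta>" and v: "0 < v"
      define R where "R = \<theta>0 * v0 / (\<theta> * v)"
      define X where "X = lag_excess \<theta>0 v0 z (s n) n k (\<theta>, v)"
      have R: "0 < R" using assms(1,3) \<theta> v by (simp add: R_def)
      have 1: "\<bar>X - (2 * R * S - 2 * (real n - k) * ln R)\<bar> \<le> C + R * (2 * e * S + C)"
        using main[OF bs elim(3) \<theta> v] by (simp only: S_def R_def X_def)
      have "2 * e * S \<le> 2 * (\<epsilon> / 16) * (2 * n)"
        using e S0 S2 assms(4) by (intro mult_mono) auto
      then have 2: "R * (2 * e * S + C) \<le> R * (\<epsilon> / 2 * n)"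
        using R kC C by (intro mult_left_mono) (auto simp: algebra_simps)
      have 3: "\<bar>2 * R * (S - n)\<bar> \<le> 2 * R * (\<epsilon> / 8 * n)"
        unfolding abs_mult using R S1 by (intro mult_mono) auto
      have 4: "\<bar>2 * real k * ln R\<bar> \<le> \<epsilon> * n * \<bar>ln R\<bar>"
        unfolding abs_mult using kC C by (intro mult_right_mono) auto
      have 5: "C \<le> \<epsilon> * n" using order_trans[OF _ kC, of C] C by simp
      have 6: "0 \<le> R * (\<epsilon> * n)" using R assms(4) by simp
      have "X - 2 * n * (R - ln R) =
          (X - (2 * R * S - 2 * (real n - k) * ln R)) + 2 * R * (S - n) + 2 * real k * ln R"
        by (simp add: algebra_simps)
      also have "\<bar>\<dots>\<bar> \<le> (C + R * (2 * e * S + C)) + 2 * R * (\<epsilon> / 8 * n) + \<epsilon> * n * \<bar>ln R\<bar>"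
        using 1 3 4 by (rule abs_triangle_three)
      also have "\<dots> \<le> (\<epsilon> * n + R * (\<epsilon> / 2 * n)) + 2 * R * (\<epsilon> / 8 * n) + \<epsilon> * n * \<bar>ln R\<bar>"
        using 2 5 by (intro add_mono order_refl)
      also have "\<dots> \<le> \<epsilon> * n * (1 + R + \<bar>ln R\<bar>)"
        using 6 by (simp add: algebra_simps)
      finally have "\<bar>X - 2 * n * (R - ln R)\<bar> \<le> \<epsilon> * n * (1 + R + \<bar>ln R\<bar>)" .
      then show "\<bar>lag_excess \<theta>0 v0 z (s n) n k (\<theta>, v)
        - 2 * n * (\<theta>0 * v0 / (\<theta> * v) - ln (\<theta>0 * v0 / (\<theta> * v)))\<bar>
     \<le> \<epsilon> * n * (1 + \<theta>0 * v0 / (\<theta> * v) + \<bar>ln (\<theta>0 * v0 / (\<theta> * v))\<bar>)"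
        by (simp only: R_def X_def)
    qed
  qed
qed

text \<open>Squared residuals are dropped. The conditional variance increases with \<theta> and
  \<open>v\<close>, so it is at least its value at \<open>(\<beta>, c)\<close>, and the last
  hypothesis puts the logarithm 2 above the reference up to \<open>2 \<beta> \<delta>\<close>. Two
  directions and the factor 2 of the reference give 4 per pair.\<close>

lemma lag_excess_lower_bound:
  assumes "0 < \<theta>0" "\<theta>0 \<le> \<beta>" "0 < v0" "1 \<le> k" "k \<le> n" and bs: "bounded_sample z s n B"
    and "\<beta> \<le> \<theta>" "0 < c" "c \<le> v" and c: "\<theta>0 * v0 * exp 2 \<le> \<beta> * c"
  shows "4 * (real n - k) - 8 * \<beta> * k \<le> lag_excess \<theta>0 v0 z s n k (\<theta>, v)"
proof -
  define I where "I = {1..n - k}"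
  define \<delta> where "\<delta> i = s (i + k) - s i" for i
  have "(\<Sum>i\<in>I. 4 - 4 * \<beta> * \<delta> i) \<le> lag_excess \<theta>0 v0 z s n k (\<theta>, v)"
    unfolding lag_excess_def I_def[symmetric]
  proof (rule sum_mono)
    fix i assume "i \<in> I"
    then have ord: "s i < s (i + k)" and \<delta>: "0 < \<delta> i"
      using bs assms(4,5) by (auto simp: bounded_sample_def I_def \<delta>_def)
    have pos: "0 < \<theta>" "0 < v" "0 < \<beta>" "0 < \<theta>0 * v0" using assms by auto
    have sp: "0 < span_ratio \<theta> (\<delta> i)" "0 < span_ratio \<beta> (\<delta> i)" "0 < span_ratio \<theta>0 (\<delta> i)"
      using span_ratio_pos pos assms(1) \<delta> by auto
    have "exp (- 2 * \<theta> * \<delta> i) \<le> exp (- 2 * \<beta> * \<delta> i)"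
      using assms(7) \<delta> by simp
    then have "\<beta> * span_ratio \<beta> (\<delta> i) \<le> \<theta> * span_ratio \<theta> (\<delta> i)"
      using pos by (simp add: span_ratio_def)
    then have "c * (\<beta> * span_ratio \<beta> (\<delta> i)) \<le> v * (\<theta> * span_ratio \<theta> (\<delta> i))"
      using assms pos sp by (intro mult_mono[of c v]) auto
    moreover have "\<theta>0 * v0 * exp 2 * span_ratio \<beta> (\<delta> i) \<le> \<beta> * c * span_ratio \<beta> (\<delta> i)"
      using c sp by (intro mult_right_mono) auto
    ultimately have "\<theta>0 * v0 * exp 2 * span_ratio \<beta> (\<delta> i) \<le> \<theta> * v * span_ratio \<theta> (\<delta> i)"
      by (simp add: mult_ac)
    then have "ln (\<theta>0 * v0 * exp 2 * span_ratio \<beta> (\<delta> i)) \<le> ln (\<theta> * v * span_ratio \<theta> (\<delta> i))"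
      using pos sp by (subst ln_le_cancel_iff) auto
    moreover have "ln (\<theta>0 * v0 * exp 2 * span_ratio \<beta> (\<delta> i)) = ln (\<theta>0 * v0) + 2 + ln (span_ratio \<beta> (\<delta> i))"
      using pos sp by (simp only: ln_mult_pos mult_pos_pos exp_gt_zero ln_exp)
    moreover have "ln (\<theta>0 * v0 * span_ratio \<theta>0 (\<delta> i)) = ln (\<theta>0 * v0) + ln (span_ratio \<theta>0 (\<delta> i))"
      using pos sp by (simp only: ln_mult_pos)
    moreover have "\<bar>ln (span_ratio \<beta> (\<delta> i)) - ln (span_ratio \<theta>0 (\<delta> i))\<bar> \<le> 2 * \<beta> * \<delta> i"
      using ln_span_ratio_diff[of \<beta> \<beta> \<theta>0] pos assms(1,2) \<delta> by simp
    ultimately have "2 - 2 * \<beta> * \<delta> i \<le> ln (\<theta> * v * span_ratio \<theta> (\<delta> i)) - ln (\<theta>0 * v0 * span_ratio \<theta>0 (\<delta> i))"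
      by linarith
    moreover have "ln (\<theta> * v * span_ratio \<theta> (\<delta> i)) \<le> cond_loglik z (s i) (s (i + k)) (\<theta>, v)"
      "ln (\<theta> * v * span_ratio \<theta> (\<delta> i)) \<le> cond_loglik z (s (i + k)) (s i) (\<theta>, v)"
    proof -
      have r: "0 < 1 - exp (- 2 * \<theta> * \<delta> i)" using pos \<delta> by simp
      have "\<theta> * v * span_ratio \<theta> (\<delta> i) = v * (1 - exp (- 2 * \<theta> * \<delta> i))"
        unfolding span_ratio_def using pos by simp
      then have l: "ln (\<theta> * v * span_ratio \<theta> (\<delta> i)) = ln v + ln (1 - exp (- 2 * \<theta> * \<delta> i))"
        using pos r by (simp only: ln_mult_pos)
      have a: "\<bar>s i - s (i + k)\<bar> = \<delta> i" "\<bar>s (i + k) - s i\<bar> = \<delta> i"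
        using ord by (auto simp: \<delta>_def)
      show "ln (\<theta> * v * span_ratio \<theta> (\<delta> i)) \<le> cond_loglik z (s i) (s (i + k)) (\<theta>, v)"
        "ln (\<theta> * v * span_ratio \<theta> (\<delta> i)) \<le> cond_loglik z (s (i + k)) (s i) (\<theta>, v)"
        unfolding l cond_loglik_def prod.case a using pos r by simp_all
    qed
    ultimately show "4 - 4 * \<beta> * \<delta> i \<le> cond_loglik z (s i) (s (i + k)) (\<theta>, v) + cond_loglik z (s (i + k)) (s i) (\<theta>, v)
        - 2 * ln (\<theta>0 * v0 * span_ratio \<theta>0 (s (i + k) - s i))"
      unfolding \<delta>_def[symmetric] by (simp add: algebra_simps)
  qed
  moreover have "(\<Sum>i\<in>I. 4 - 4 * \<beta> * \<delta> i) = 4 * (real n - k) - 4 * \<beta> * (\<Sum>i\<in>I. \<delta> i)"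
    using assms(5) by (simp add: sum_subtractf sum_distrib_left I_def of_nat_diff)
  moreover have "4 * \<beta> * (\<Sum>i\<in>I. \<delta> i) \<le> 4 * \<beta> * (2 * real k)"
    using bounded_sample_sum_spacings[OF bs assms(5)] assms(1,2)
    by (intro mult_left_mono) (auto simp: I_def \<delta>_def)
  ultimately show ?thesis by simp
qed

section \<open>Convergence of the minimisers\<close>

text \<open>Square roots make the bound global: \<open>(r - 1)^2\<close> is not controlled by a
  function of linear growth for large \<open>r\<close>. The second inequality turns the error
  \<open>1 + R + |ln R|\<close> of the expansion into a multiple of the deficit plus a
  constant.\<close>

lemma ln_deficit_ge:
  fixes r :: real
  assumes "0 < r"
  shows "(sqrt r - 1)\<^sup>2 \<le> r - 1 - ln r" and "r + \<bar>ln r\<bar> \<le> 4 * (r - 1 - ln r) + 4"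
proof -
  have "ln (sqrt r) \<le> sqrt r - 1" using assms by (intro ln_le_minus_one) simp
  then have *: "ln r \<le> 2 * (sqrt r - 1)" using assms by (simp add: ln_sqrt)
  have "(sqrt r - 1)\<^sup>2 = r - 2 * sqrt r + 1"
    using assms by (simp add: power2_diff)
  with * show "(sqrt r - 1)\<^sup>2 \<le> r - 1 - ln r" by simp
  have "ln (r / 2) \<le> r / 2 - 1" using assms by (intro ln_le_minus_one) simp
  moreover have "ln (r / 2) = ln r - ln 2" using assms by (simp add: ln_divide_pos)
  moreover have "ln 2 \<le> (1::real)" using ln_2_less_1 by simp
  ultimately have "ln r \<le> r / 2" by simp
  moreover have "ln r \<le> r - 1" using assms by (rule ln_le_minus_one)
  ultimately show "r + \<bar>ln r\<bar> \<le> 4 * (r - 1 - ln r) + 4" using assms by (auto simp: abs_if)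
qed

text \<open>One competitor with \<open>R = 1\<close> suffices: it bounds the minimum from above, and
  the expansion converts this into a small deficit of the minimiser. The disjunction in the
  hypothesis on \<open>J\<close> separates the range of the expansion from the range of the
  logarithmic lower bound.\<close>

lemma minimizer_product_tendsto:
  fixes \<psi> :: "nat \<Rightarrow> real \<times> real"
  assumes "0 < \<theta>0" "\<theta>0 \<le> \<beta>" "0 < v0"
    and bs: "\<And>n. bounded_sample z (s n) n B"
    and law: "\<And>k. k \<in> {1..K} \<Longrightarrow> (\<lambda>n. sq_innov_sum \<theta>0 v0 z (s n) n k / n) \<longlonglongrightarrow> 1"
    and w: "\<And>k. 1 \<le> k \<Longrightarrow> 0 \<le> w k" "\<exists>k\<in>{1..K}. w k \<noteq> 0" "\<And>k. K < k \<Longrightarrow> w k = 0"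
    and J: "\<And>\<theta> v. (\<theta>, v) \<in> J \<Longrightarrow> 0 < \<theta> \<and> 0 < v \<and> (\<theta> \<le> \<beta> \<or> c \<le> v)"
    and c: "0 < c" "\<theta>0 * v0 * exp 2 \<le> \<beta> * c"
    and wit: "(\<theta>1, v1) \<in> J" "\<theta>1 * v1 = \<theta>0 * v0" "\<theta>1 \<le> \<beta>"
    and min: "\<forall>\<^sub>F n in sequentially. is_arg_min (pair_cond_loglik w n (s n) z) (\<lambda>\<psi>. \<psi> \<in> J) (\<psi> n)"
  shows "(\<lambda>n. fst (\<psi> n) * snd (\<psi> n)) \<longlonglongrightarrow> \<theta>0 * v0"
proof -
  define p0 where "p0 = \<theta>0 * v0"
  have p0: "0 < p0" using assms by (simp add: p0_def)
  define wbar where "wbar = (\<Sum>k\<in>{1..K}. w k)"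
  have wbar: "0 < wbar"
  proof -
    obtain k where "k \<in> {1..K}" "w k \<noteq> 0" using w(2) by blast
    moreover from this have "0 < w k" using w(1)[of k] by (simp add: less_le)
    ultimately show ?thesis
      unfolding wbar_def using w(1) by (intro sum_pos2[of _ k]) auto
  qed
  define D where "D n \<phi> = (\<Sum>k\<in>{1..K}. w k * lag_excess \<theta>0 v0 z (s n) n k \<phi>)" for n \<phi>
  define b where "b n = (\<Sum>k\<in>{1..K}. w k * (\<Sum>i\<in>{1..n - k}. 2 * ln (\<theta>0 * v0 * span_ratio \<theta>0 (s n (i + k) - s n i))))" for n
  have pcl: "pair_cond_loglik w n (s n) z \<phi> = D n \<phi> + b n" for n \<phi>
  proof -
    have "D n \<phi> + b n = (\<Sum>k\<in>{1..K}. w k * (\<Sum>i\<in>{1..n - k}.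
       cond_loglik z (s n i) (s n (i + k)) \<phi> + cond_loglik z (s n (i + k)) (s n i) \<phi>))"
      unfolding D_def b_def lag_excess_def sum.distrib[symmetric] distrib_left[symmetric] by simp
    also have "\<dots> = pair_cond_loglik w n (s n) z \<phi>"
      by (rule pair_cond_loglik_lag_sum[symmetric]) (rule w(3))
    finally show ?thesis by simp
  qed
  define R where "R n = p0 / (fst (\<psi> n) * snd (\<psi> n))" for n
  have asym: "\<forall>\<^sub>F n in sequentially. \<forall>\<theta> v. 0 < \<theta> \<longrightarrow> \<theta> \<le> \<beta> \<longrightarrow> 0 < v \<longrightarrow>
     \<bar>D n (\<theta>, v) - wbar * (2 * n * (p0 / (\<theta> * v) - ln (p0 / (\<theta> * v))))\<bar>
     \<le> wbar * (\<epsilon> * n * (1 + p0 / (\<theta> * v) + \<bar>ln (p0 / (\<theta> * v))\<bar>))" if "0 < \<epsilon>" for \<epsilon> :: real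
  proof -
    have "\<forall>\<^sub>F n in sequentially. \<forall>k\<in>{1..K}. \<forall>\<theta> v. 0 < \<theta> \<longrightarrow> \<theta> \<le> \<beta> \<longrightarrow> 0 < v \<longrightarrow>
     \<bar>lag_excess \<theta>0 v0 z (s n) n k (\<theta>, v)
        - 2 * n * (\<theta>0 * v0 / (\<theta> * v) - ln (\<theta>0 * v0 / (\<theta> * v)))\<bar>
     \<le> \<epsilon> * n * (1 + \<theta>0 * v0 / (\<theta> * v) + \<bar>ln (\<theta>0 * v0 / (\<theta> * v))\<bar>)"
      using lag_excess_asymptotics[where B = B, OF assms(1-3) that _ bs law]
      by (intro eventually_ball_finite) auto
    then show ?thesis
    proof eventually_elim
      case (elim n)
      show ?case
      proof (intro allI impI)
        fix \<theta> v :: real assume tv: "0 < \<theta>" "\<theta> \<le> \<beta>" "0 < v"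
        let ?a = "2 * n * (p0 / (\<theta> * v) - ln (p0 / (\<theta> * v)))"
        let ?r = "\<epsilon> * n * (1 + p0 / (\<theta> * v) + \<bar>ln (p0 / (\<theta> * v))\<bar>)"
        have "\<bar>D n (\<theta>, v) - (\<Sum>k\<in>{1..K}. w k * ?a)\<bar> \<le> (\<Sum>k\<in>{1..K}. w k * ?r)"
          unfolding D_def
        proof (rule abs_sum_diff_le)
          fix k assume k: "k \<in> {1..K}"
          have "\<bar>lag_excess \<theta>0 v0 z (s n) n k (\<theta>, v) - ?a\<bar> \<le> ?r"
            using elim k tv unfolding p0_def by blast
          then have "w k * \<bar>lag_excess \<theta>0 v0 z (s n) n k (\<theta>, v) - ?a\<bar> \<le> w k * ?r"
            using w(1) k by (intro mult_left_mono) auto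
          moreover have "\<bar>w k * lag_excess \<theta>0 v0 z (s n) n k (\<theta>, v) - w k * ?a\<bar>
              = w k * \<bar>lag_excess \<theta>0 v0 z (s n) n k (\<theta>, v) - ?a\<bar>"
            using w(1) k unfolding right_diff_distrib[symmetric] by (simp only: abs_mult) simp
          ultimately show "\<bar>w k * lag_excess \<theta>0 v0 z (s n) n k (\<theta>, v) - w k * ?a\<bar> \<le> w k * ?r"
            by simp
        qed
        then show "\<bar>D n (\<theta>, v) - wbar * ?a\<bar> \<le> wbar * ?r"
          unfolding wbar_def sum_distrib_right .
      qed
    qed
  qed
  have minD: "\<forall>\<^sub>F n in sequentially. \<psi> n \<in> J \<and> D n (\<psi> n) \<le> D n (\<theta>1, v1)"
    using min
  proof eventually_elim
    case (elim n)
    then have "\<psi> n \<in> J" "\<not> pair_cond_loglik w n (s n) z (\<theta>1, v1) < pair_cond_loglik w n (s n) z (\<psi> n)"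
      using wit(1) by (auto simp: is_arg_min_def)
    then show ?case by (simp add: pcl)
  qed
  have wit': "0 < \<theta>1" "0 < v1" "p0 / (\<theta>1 * v1) = 1"
    using J[OF wit(1)] wit(2) p0 by (auto simp: p0_def)
  have bnd: "\<forall>\<^sub>F n in sequentially. fst (\<psi> n) \<le> \<beta>"
  proof -
    \<comment> \<open>This threshold is \<open>4 (n - K) - 8 \<beta> K > 3 n\<close>. The
      \<open>3 n\<close> is the competitor's value \<open>2 n\<close> plus the error
      \<open>n\<close> of the expansion with \<open>\<epsilon> = 1 / 2\<close> at
      \<open>R = 1\<close>.\<close>
    have "\<forall>\<^sub>F n in sequentially. 4 * K + 8 * \<beta> * K < real n"
      using filterlim_real_sequentially by (auto simp: filterlim_at_top_dense)
    then show ?thesis using asym[of "1 / 2", simplified] minD eventually_ge_at_top[of K]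
    proof eventually_elim
      case (elim n)
      show ?case
      proof (rule ccontr)
        assume "\<not> fst (\<psi> n) \<le> \<beta>"
        moreover obtain \<theta> v where \<psi>n: "\<psi> n = (\<theta>, v)" by (cases "\<psi> n")
        ultimately have \<theta>: "\<beta> \<le> \<theta>" "c \<le> v" using J[of \<theta> v] elim(3) by auto
        have "wbar * (4 * (real n - K) - 8 * \<beta> * K) \<le> D n (\<theta>, v)"
          unfolding D_def wbar_def sum_distrib_right
        proof (intro sum_mono mult_left_mono)
          fix k assume k: "k \<in> {1..K}"
          show "0 \<le> w k" using w(1) k by simp
          have "4 * (real n - k) - 8 * \<beta> * k \<le> lag_excess \<theta>0 v0 z (s n) n k (\<theta>, v)"
            using k elim(4) by (intro lag_excess_lower_bound[OF assms(1-3) _ _ bs \<theta>(1) c(1) \<theta>(2) c(2)]) auto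
          moreover have "8 * \<beta> * k \<le> 8 * \<beta> * K" using k assms(1,2) by (intro mult_left_mono) auto
          ultimately show "4 * (real n - K) - 8 * \<beta> * K \<le> lag_excess \<theta>0 v0 z (s n) n k (\<theta>, v)"
            using k by auto
        qed
        moreover have "D n (\<theta>1, v1) \<le> wbar * (3 * n)"
          using elim(2)[rule_format, OF wit'(1) wit(3) wit'(2)] unfolding wit'(3)
          by (simp add: abs_le_iff algebra_simps)
        ultimately have "wbar * (4 * (real n - K) - 8 * \<beta> * K) \<le> wbar * (3 * n)"
          using elim(3) \<psi>n by simp
        then show False using wbar elim(1) by simp
      qed
    qed
  qed
  have "(\<lambda>n. (sqrt (R n) - 1)\<^sup>2) \<longlonglongrightarrow> 0"
  proof (rule tendstoI)
    fix x :: real assume x: "0 < x"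
    \<comment> \<open>The comparison gives \<open>2 f \<le> \<epsilon> (7 + 4 f)\<close>. The bound
      \<open>1 / 4\<close> absorbs \<open>4 \<epsilon> f\<close> into \<open>f\<close>, and
      \<open>x / 14\<close> leaves \<open>7 \<epsilon> < x\<close>.\<close>
    define \<epsilon> where "\<epsilon> = min (1 / 4) (x / 14)"
    have \<epsilon>: "0 < \<epsilon>" "\<epsilon> \<le> 1 / 4" "7 * \<epsilon> < x" using x by (auto simp: \<epsilon>_def min_def)
    show "\<forall>\<^sub>F n in sequentially. dist ((sqrt (R n) - 1)\<^sup>2) 0 < x"
      using asym[OF \<epsilon>(1)] minD bnd eventually_gt_at_top[of 0]
    proof eventually_elim
      case (elim n)
      obtain \<theta> v where \<psi>n: "\<psi> n = (\<theta>, v)" by (cases "\<psi> n")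
      have tv: "0 < \<theta>" "\<theta> \<le> \<beta>" "0 < v" using J[of \<theta> v] elim(2,3) \<psi>n by auto
      define r where "r = p0 / (\<theta> * v)"
      have r: "0 < r" "R n = r" using tv p0 by (auto simp: r_def R_def \<psi>n)
      define f where "f = r - 1 - ln r"
      have "wbar * (2 * n * (r - ln r)) - wbar * (\<epsilon> * n * (1 + r + \<bar>ln r\<bar>)) \<le> D n (\<theta>, v)"
        using elim(1)[rule_format, OF tv] unfolding r_def[symmetric] by linarith
      also have "\<dots> \<le> D n (\<theta>1, v1)" using elim(2) \<psi>n by simp
      also have "\<dots> \<le> wbar * (2 * n * 1) + wbar * (\<epsilon> * n * 2)"
        using elim(1)[rule_format, OF wit'(1) wit(3) wit'(2)] unfolding wit'(3)
        by (simp add: abs_le_iff)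
      finally have "wbar * n * (2 * f) \<le> wbar * n * (\<epsilon> * (3 + r + \<bar>ln r\<bar>))"
        by (simp add: f_def algebra_simps)
      then have "2 * f \<le> \<epsilon> * (3 + r + \<bar>ln r\<bar>)"
        using wbar elim(4) by (subst (asm) mult_le_cancel_left_pos) auto
      also have "\<dots> \<le> \<epsilon> * (7 + 4 * f)"
        using ln_deficit_ge(2)[OF r(1)] \<epsilon> by (intro mult_left_mono) (auto simp: f_def)
      also have "\<dots> \<le> 7 * \<epsilon> + f"
      proof -
        have "0 \<le> f" using ln_le_minus_one[OF r(1)] by (simp add: f_def)
        then have "\<epsilon> * 4 * f \<le> 1 * f" using \<epsilon> by (intro mult_right_mono) auto
        then show ?thesis by (simp add: algebra_simps)
      qed
      finally have "f < x" using \<epsilon>(3) by simp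
      then show ?case using ln_deficit_ge(1)[OF r(1)] r(2) by (simp add: f_def)
    qed
  qed
  then have "(\<lambda>n. sqrt ((sqrt (R n) - 1)\<^sup>2)) \<longlonglongrightarrow> sqrt 0"
    by (rule tendsto_real_sqrt)
  then have "(\<lambda>n. sqrt (R n) - 1) \<longlonglongrightarrow> 0"
    by (simp add: tendsto_rabs_zero_iff)
  then have "(\<lambda>n. (sqrt (R n) - 1 + 1)\<^sup>2) \<longlonglongrightarrow> (0 + 1)\<^sup>2"
    by (intro tendsto_intros)
  then have "(\<lambda>n. p0 / (sqrt (R n))\<^sup>2) \<longlonglongrightarrow> p0 / 1"
    by (intro tendsto_intros) auto
  moreover have "\<forall>\<^sub>F n in sequentially. p0 / (sqrt (R n))\<^sup>2 = fst (\<psi> n) * snd (\<psi> n)"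
    using minD
  proof eventually_elim
    case (elim n)
    then have "0 < fst (\<psi> n)" "0 < snd (\<psi> n)" using J[of "fst (\<psi> n)" "snd (\<psi> n)"] by auto
    then show ?case using p0 by (simp add: R_def)
  qed
  ultimately show ?thesis
    unfolding p0_def[symmetric] by (simp add: tendsto_cong)
qed

section \<open>Consistency\<close>

lemma finite_weight_range:
  assumes "weight_range w < \<infinity>"
  obtains K where "\<And>k. K < k \<Longrightarrow> w k = 0"
proof -
  obtain K where K: "weight_range w = enat K"
    using assms by (cases "weight_range w") auto
  have "w k = 0" if "K < k" for k
  proof (rule ccontr)
    assume "w k \<noteq> 0"
    then have "enat k \<le> weight_range w"
      unfolding weight_range_def using that by (intro SUP_upper) auto
    then show False using that K by simp
  qed
  then show ?thesis by (rule that)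
qed

theorem theorem2:
  fixes M :: "'a measure" and Z :: "real \<Rightarrow> 'a \<Rightarrow> real"
    and \<theta>0 v0 :: real
    and s :: "nat \<Rightarrow> nat \<Rightarrow> real" and w :: "nat \<Rightarrow> real"
    and a b c d :: real and J :: "(real \<times> real) set"
    and \<psi>hat :: "nat \<Rightarrow> 'a \<Rightarrow> real \<times> real"
  assumes "0 < \<theta>0" and "0 < v0"
    and "OU_process M Z \<theta>0 v0"
    and "observation_array s"
    and "\<And>k. 1 \<le> k \<Longrightarrow> 0 \<le> w k"
    and "\<exists>k\<ge>1. w k \<noteq> 0"
    and "weight_range w < \<infinity>"
    and "0 < a" and "a \<le> b" and "0 < c" and "c \<le> d"
    and "J = {a..b} \<times> {c..d} \<or> J = {a..b} \<times> {0<..} \<or> J = {0<..} \<times> {c..d}"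
    and "\<exists>\<theta> v. (\<theta>, v) \<in> J \<and> \<theta> * v = \<theta>0 * v0"
    and "pair_cond_MLE M Z w s J \<psi>hat"
  shows "AE \<omega> in M. (\<lambda>n. fst (\<psi>hat n \<omega>) * snd (\<psi>hat n \<omega>)) \<longlonglongrightarrow> \<theta>0 * v0"
proof -
  obtain K where K: "\<And>k. K < k \<Longrightarrow> w k = 0"
    using finite_weight_range[OF assms(7)] by blast
  obtain k where k: "1 \<le> k" "w k \<noteq> 0" using assms(6) by blast
  then have kK: "\<exists>k\<in>{1..K}. w k \<noteq> 0" using K by (metis atLeastAtMost_iff not_le)
  obtain \<theta>1 v1 where wit: "(\<theta>1, v1) \<in> J" "\<theta>1 * v1 = \<theta>0 * v0" using assms(13) by blast
  \<comment> \<open>\<open>\<beta>\<close> dominates the true and the witness \<theta>;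
    \<open>b\<close> brings the two shapes with bounded \<theta> under the expansion, and the last
    entry excludes large \<theta> when \<open>v \<ge> c\<close>.\<close>
  define \<beta> where "\<beta> = max (max \<theta>0 \<theta>1) (max b (\<theta>0 * v0 * exp 2 / c))"
  have \<beta>: "\<theta>0 \<le> \<beta>" "\<theta>1 \<le> \<beta>" "b \<le> \<beta>" "\<theta>0 * v0 * exp 2 / c \<le> \<beta>" by (auto simp: \<beta>_def)
  then have c: "\<theta>0 * v0 * exp 2 \<le> \<beta> * c" using assms(10) by (simp add: field_simps)
  have J: "0 < \<theta> \<and> 0 < v \<and> (\<theta> \<le> \<beta> \<or> c \<le> v)" if "(\<theta>, v) \<in> J" for \<theta> v
    using that assms(8-12) \<beta>(3) by auto
  have "AE \<omega> in M. \<forall>k\<in>{1..K}.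
      (\<lambda>n. (\<Sum>i\<in>{1..n - k}. (innov \<theta>0 v0 (\<lambda>t. Z t \<omega>) (s n i) (s n (i + k)))\<^sup>2) / n) \<longlonglongrightarrow> 1"
    using innov_strong_law[OF assms(3,1,2,4)] by (intro AE_finite_allI) auto
  moreover have "AE \<omega> in M. continuous_on {0..1} (\<lambda>t. Z t \<omega>)"
    using assms(3) by (simp add: OU_process_def)
  ultimately show ?thesis using assms(14)[unfolded pair_cond_MLE_def]
  proof eventually_elim
    case (elim \<omega>)
    \<comment> \<open>The bound may depend on the outcome but serves all sample sizes at once; only
      this consequence of path continuity is used.\<close>
    have "bounded ((\<lambda>t. Z t \<omega>) ` {0..1})"
      using elim(2) by (intro compact_imp_bounded compact_continuous_image) auto
    then obtain B where B: "\<forall>t\<in>{0..1}. \<bar>Z t \<omega>\<bar> \<le> B"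
      by (auto simp: bounded_iff)
    show ?case
    proof (rule minimizer_product_tendsto[OF assms(1) \<beta>(1) assms(2) _ _ _ kK _ _ assms(10) c wit \<beta>(2) elim(3)])
      show "bounded_sample (\<lambda>t. Z t \<omega>) (s n) n B" for n
        unfolding bounded_sample_def using observation_arrayD[OF assms(4)] B by auto
      show "(\<lambda>n. sq_innov_sum \<theta>0 v0 (\<lambda>t. Z t \<omega>) (s n) n k / n) \<longlonglongrightarrow> 1" if "k \<in> {1..K}" for k
        using elim(1) that by (simp add: sq_innov_sum_def)
    qed (use K J assms(5) in auto)
  qed
qed

end
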